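(* Let $a,b\in\mathbb{Z}$, let $f(x)=x^6+ax^3+b\in\mathbb{Q}[x]$, let $\Delta=a^2-4b$, and let $F$ be the splitting field of $f(x)$ over $\mathbb{Q}$. Consider the following infinite families of $a,b$ when $f(x)$ is irreducible over $\mathbb{Q}$ and $\Delta\neq -3n^2$ for every $n\in\mathbb{Q}$. Then in the following cases $\operatorname{Gal}(F/\mathbb{Q})\cong S_3\times S_3$: 1. $b=2$ and $a\equiv 1\bmod 10$; 2. $b=27(100m+23)^3+1$ with $m\leq -1$ an integer, and $a\equiv 25\bmod 30$; while in the following cases $\operatorname{Gal}(F/\mathbb{Q})\cong D_6$: 3. $b\equiv 10\bmod 12$ and $a=0$; 4. $b=-(5m+1)^3$ with $m>0$ an integer, and $a\equiv 3\bmod 5$.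
   Context: $D_6$ is the dihedral group of order $12$ and $S_3$ is the symmetric group on $3$ letters. *)

theory Defs
  imports
    "HOL-Algebra.Algebra"
    "HOL-Algebra.Algebraic_Closure_Type"
    "HOL-Number_Theory.Cong"
begin

text \<open>The splitting field is realised inside the complex numbers, as the subfield generated
  over \<open>\<rat>\<close> by all complex roots.\<close>

definition splitting_field :: "rat poly \<Rightarrow> complex ring"
  where "splitting_field p =
    ring_of_type_algebra\<lparr>carrier :=
      generate_field ring_of_type_algebra (\<rat> \<union> {z. poly (map_poly of_rat p) z = 0})\<rparr>"

text \<open>As for \<open>AutoGroup\<close>, automorphisms are taken to be extensional, so that each of them is
  represented by exactly one function.\<close>

definition galois_group :: "('a, 'b) ring_scheme \<Rightarrow> 'a set \<Rightarrow> ('a \<Rightarrow> 'a) monoid"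
  where "galois_group F K = BijGroup (carrier F)
    \<lparr>carrier := {\<sigma> \<in> Bij (carrier F). \<sigma> \<in> ring_iso F F \<and> (\<forall>x\<in>K. \<sigma> x = x)}\<rparr>"

text \<open>The dihedral group of order \<open>2n\<close>: the pair \<open>(k, e)\<close> with \<open>e = \<plusminus>1\<close> stands for the
  symmetry \<open>x \<mapsto> e x + k\<close> of the regular \<open>n\<close>-gon with vertex set \<open>\<int>/n\<int>\<close>.\<close>

definition dihedral_group :: "nat \<Rightarrow> (int \<times> int) monoid"
  where "dihedral_group n =
    \<lparr>carrier = {0..<int n} \<times> {1, -1},
     monoid.mult = (\<lambda>(k, e) (l, d). ((k + e * l) mod int n, e * d)),
     one = (0, 1)\<rparr>"

lemma order_dihedral_group: "Coset.order (dihedral_group n) = 2 * n"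
  by (simp add: Coset.order_def dihedral_group_def card_cartesian_product)

lemma group_dihedral_group:
  assumes "n > 0"
  shows "group (dihedral_group n)"
proof (rule groupI)
  fix x y z
  assume "x \<in> carrier (dihedral_group n)" "y \<in> carrier (dihedral_group n)"
    "z \<in> carrier (dihedral_group n)"
  then show "x \<otimes>\<^bsub>dihedral_group n\<^esub> y \<otimes>\<^bsub>dihedral_group n\<^esub> z =
      x \<otimes>\<^bsub>dihedral_group n\<^esub> (y \<otimes>\<^bsub>dihedral_group n\<^esub> z)"
    by (auto simp: dihedral_group_def mod_simps algebra_simps)
next
  fix x
  assume x: "x \<in> carrier (dihedral_group n)"
  obtain k e where ke: "x = (k, e)" by (cases x)
  have "((- e * k) mod int n, e) \<in> carrier (dihedral_group n)"
    and "((- e * k) mod int n, e) \<otimes>\<^bsub>dihedral_group n\<^esub> x = \<one>\<^bsub>dihedral_group n\<^esub>"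
    using x assms by (auto simp: ke dihedral_group_def mod_simps)
  then show "\<exists>y\<in>carrier (dihedral_group n). y \<otimes>\<^bsub>dihedral_group n\<^esub> x = \<one>\<^bsub>dihedral_group n\<^esub>"
    by blast
qed (use assms in \<open>auto simp: dihedral_group_def\<close>)

end

theory Submission
  imports Defs
begin

text \<open>
  Let \<open>u\<close>, \<open>v\<close> be the roots of \<open>x\<^sup>2 + a x + b\<close> and \<open>\<alpha>\<close>, \<open>\<beta>\<close> cube roots of \<open>u\<close>, \<open>v\<close>. Over
  \<open>K = \<rat>(\<surd>\<Delta>, \<surd>-3)\<close>, of degree 4, the splitting field is generated by \<open>\<alpha>\<close> and \<open>\<beta>\<close>, and every
  automorphism arises by extending homomorphisms along a tower of pure quadratic and cubic
  extensions. An element of a field of characteristic 0 that becomes a cube in a quadratic extension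
  is a cube already, so irreducibility of \<open>f\<close> means that \<open>u\<close> and \<open>v\<close> are not cubes in \<open>K\<close>.

  By Kummer theory, \<open>[K(\<alpha>, \<beta>) : K] = 9\<close> unless \<open>b = u v\<close> or \<open>u b = u\<^sup>2 v\<close> is a cube in \<open>K\<close>. The former
  makes \<open>b\<close> a rational cube, the latter gives \<open>s\<^sup>3 - 3 b s + a b\<close> a rational root. In the first two
  families both are excluded by looking modulo 4, since \<open>a\<close> is odd and \<open>b \<equiv> 2\<close>. With
  \<open>w = \<alpha>\<beta>\<close>, \<open>t = \<alpha>\<^sup>2\<beta>\<close>, \<open>t' = \<alpha>\<beta>\<^sup>2\<close> the Galois group then permutes independently the three roots
  \<open>\<omega>\<^sup>j w\<close> of \<open>x\<^sup>3 - b\<close> and the three roots \<open>\<omega>\<^sup>j t + \<omega>\<^sup>-\<^sup>j t'\<close> of \<open>x\<^sup>3 - 3 b x + a b\<close>.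

  If \<open>b = c\<^sup>3\<close>, choose \<open>\<beta> = c / \<alpha>\<close>: the group acts on the indices modulo 3 of
  \<open>\<omega>\<^sup>j \<alpha> + \<omega>\<^sup>-\<^sup>j \<beta>\<close> and on the sign of \<open>\<surd>-3\<close>, and combining both gives the action of \<open>D\<^sub>6\<close> on the
  residues modulo 6. If \<open>a = 0\<close>, choose \<open>\<beta> = -\<alpha>\<close>: the group acts on the hexagon of roots of \<open>x\<^sup>6 + b\<close>.
\<close>

subsection \<open>Subfields and their homomorphisms\<close>

text \<open>Closure under \<open>inverse\<close> is asked of 0 as well, which is harmless by the
  convention \<open>inverse 0 = 0\<close>; the element 0 itself is obtained as
  \<open>1 + (- 1)\<close>.\<close>

definition is_subfield :: "'a::field set \<Rightarrow> bool"
  where "is_subfield K \<longleftrightarrow> 1 \<in> K \<and> (\<forall>x\<in>K. - x \<in> K \<and> inverse x \<in> K) \<and>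
    (\<forall>x\<in>K. \<forall>y\<in>K. x + y \<in> K \<and> x * y \<in> K)"

text \<open>Only the values on \<open>K\<close> are constrained and no target set is prescribed, so
  one notion covers both embeddings of a tower of extensions and automorphisms of the splitting
  field.\<close>

definition field_hom_on :: "'a::field set \<Rightarrow> ('a \<Rightarrow> 'b::field) \<Rightarrow> bool"
  where "field_hom_on K \<phi> \<longleftrightarrow> \<phi> 1 = 1 \<and>
    (\<forall>x\<in>K. \<forall>y\<in>K. \<phi> (x + y) = \<phi> x + \<phi> y \<and> \<phi> (x * y) = \<phi> x * \<phi> y)"

context
  fixes K :: "'a::field set"
  assumes K: "is_subfield K"
begin

lemma subfield_1: "1 \<in> K"
  and subfield_uminus: "x \<in> K \<Longrightarrow> - x \<in> K"
  and subfield_inverse: "x \<in> K \<Longrightarrow> inverse x \<in> K"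
  and subfield_add: "x \<in> K \<Longrightarrow> y \<in> K \<Longrightarrow> x + y \<in> K"
  and subfield_mult: "x \<in> K \<Longrightarrow> y \<in> K \<Longrightarrow> x * y \<in> K"
  using K by (auto simp: is_subfield_def)

lemma subfield_0: "0 \<in> K"
  using subfield_add[OF subfield_1 subfield_uminus[OF subfield_1]] by simp

lemma subfield_diff: "x \<in> K \<Longrightarrow> y \<in> K \<Longrightarrow> x - y \<in> K"
  using subfield_add[of x "- y"] subfield_uminus[of y] by simp

lemma subfield_divide: "x \<in> K \<Longrightarrow> y \<in> K \<Longrightarrow> x / y \<in> K"
  using subfield_mult[of x "inverse y"] subfield_inverse[of y] by (simp add: field_simps)

lemma subfield_power: "x \<in> K \<Longrightarrow> x ^ n \<in> K"
  by (induction n) (auto intro: subfield_1 subfield_mult)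

lemma subfield_power_int: "x \<in> K \<Longrightarrow> x powi n \<in> K"
  by (cases "n \<ge> 0") (auto simp: power_int_def intro: subfield_power subfield_inverse)

lemma subfield_of_nat: "of_nat n \<in> K"
  by (induction n) (auto intro: subfield_0 subfield_1 subfield_add)

lemma subfield_of_int: "of_int n \<in> K"
  by (cases n rule: int_cases2) (auto intro: subfield_of_nat subfield_uminus)

lemma subfield_numeral: "numeral n \<in> K"
  using subfield_of_nat[of "numeral n"] by simp

lemmas subfield_closed = subfield_0 subfield_1 subfield_uminus subfield_inverse subfield_add
  subfield_mult subfield_diff subfield_divide subfield_power subfield_power_int
  subfield_numeral subfield_of_int

end

lemma Rats_subset_subfield:
  fixes K :: "'a::field_char_0 set"
  assumes "is_subfield K"
  shows "\<rat> \<subseteq> K"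
proof
  fix x :: 'a
  assume "x \<in> \<rat>"
  then obtain m n :: int where "x = of_int m / of_int n"
    by (metis Rats_cases' of_int_def)
  then show "x \<in> K"
    using assms by (auto intro: subfield_divide subfield_of_int)
qed

lemma is_subfield_Rats: "is_subfield (\<rat> :: 'a::field_char_0 set)"
  by (auto simp: is_subfield_def)

section \<open>Homomorphisms defined on a subfield\<close>

context
  fixes K :: "'a::field set" and \<phi> :: "'a \<Rightarrow> 'b::field"
  assumes K: "is_subfield K" and hom: "field_hom_on K \<phi>"
begin

lemma hom_1: "\<phi> 1 = 1"
  and hom_add: "x \<in> K \<Longrightarrow> y \<in> K \<Longrightarrow> \<phi> (x + y) = \<phi> x + \<phi> y"
  and hom_mult: "x \<in> K \<Longrightarrow> y \<in> K \<Longrightarrow> \<phi> (x * y) = \<phi> x * \<phi> y"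
  using hom by (auto simp: field_hom_on_def)

lemma hom_0: "\<phi> 0 = 0"
  using hom_add[of 0 0] subfield_0[OF K] by (metis add_0 add_cancel_right_right)

lemma hom_uminus: "x \<in> K \<Longrightarrow> \<phi> (- x) = - \<phi> x"
  using hom_add[of x "- x"] subfield_uminus[OF K, of x] hom_0
  by (simp add: eq_neg_iff_add_eq_0 add.commute)

lemma hom_diff: "x \<in> K \<Longrightarrow> y \<in> K \<Longrightarrow> \<phi> (x - y) = \<phi> x - \<phi> y"
  using hom_add[of x "- y"] hom_uminus[of y] subfield_uminus[OF K, of y] by simp

lemma hom_inverse:
  assumes "x \<in> K"
  shows "\<phi> (inverse x) = inverse (\<phi> x)"
proof (cases "x = 0")
  case False
  have "\<phi> x * \<phi> (inverse x) = 1"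
    using hom_mult[OF assms subfield_inverse[OF K assms]] False hom_1 by simp
  then show ?thesis
    by (metis inverse_unique)
qed (simp add: hom_0)

lemma hom_divide: "x \<in> K \<Longrightarrow> y \<in> K \<Longrightarrow> \<phi> (x / y) = \<phi> x / \<phi> y"
  using hom_mult[of x "inverse y"] subfield_inverse[OF K, of y] hom_inverse[of y]
  by (simp add: field_simps)

lemma hom_power: "x \<in> K \<Longrightarrow> \<phi> (x ^ n) = \<phi> x ^ n"
  by (induction n) (auto simp: hom_1 hom_mult subfield_power[OF K])

lemma hom_power_int: "x \<in> K \<Longrightarrow> \<phi> (x powi n) = \<phi> x powi n"
  by (auto simp: power_int_def hom_power hom_inverse subfield_inverse[OF K])

lemma hom_of_nat: "\<phi> (of_nat n) = of_nat n"
  by (induction n) (auto simp: hom_0 hom_1 hom_add subfield_of_nat[OF K] subfield_1[OF K])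

lemma hom_of_int: "\<phi> (of_int n) = of_int n"
  by (cases n rule: int_cases2)
    (auto simp: hom_of_nat hom_uminus subfield_of_nat[OF K])

lemma hom_numeral: "\<phi> (numeral n) = numeral n"
  using hom_of_nat[of "numeral n"] by simp

lemmas hom_simps = hom_0 hom_1 hom_add hom_mult hom_uminus hom_diff hom_inverse hom_divide
  hom_power hom_power_int hom_of_int hom_numeral

lemma hom_eq_0_iff: "x \<in> K \<Longrightarrow> \<phi> x = 0 \<longleftrightarrow> x = 0"
proof
  assume x: "x \<in> K" "\<phi> x = 0"
  show "x = 0"
  proof (rule ccontr)
    assume "x \<noteq> 0"
    then show False
      using hom_mult[of x "inverse x"] x subfield_inverse[OF K, of x] hom_1 by simp
  qed
qed (simp add: hom_0)

lemma hom_inj_on: "inj_on \<phi> K"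
proof (rule inj_onI)
  fix x y
  assume "x \<in> K" "y \<in> K" "\<phi> x = \<phi> y"
  then show "x = y"
    using hom_eq_0_iff[of "x - y"] subfield_diff[OF K] by (simp add: hom_diff)
qed

lemma is_subfield_image: "is_subfield (\<phi> ` K)"
  unfolding is_subfield_def
proof (intro conjI ballI)
  show "1 \<in> \<phi> ` K"
    using hom_1 subfield_1[OF K] by (metis imageI)
next
  fix x assume "x \<in> \<phi> ` K"
  then obtain x' where x: "x' \<in> K" "x = \<phi> x'"
    by blast
  then show "- x \<in> \<phi> ` K" "inverse x \<in> \<phi> ` K"
    using hom_uminus[of x'] hom_inverse[of x'] subfield_uminus[OF K] subfield_inverse[OF K]
    by (metis imageI)+
  fix y assume "y \<in> \<phi> ` K"
  then obtain y' where y: "y' \<in> K" "y = \<phi> y'"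
    by blast
  show "x + y \<in> \<phi> ` K" "x * y \<in> \<phi> ` K"
    using x y hom_add[of x' y'] hom_mult[of x' y'] subfield_add[OF K] subfield_mult[OF K]
    by (metis imageI)+
qed

text \<open>Allows to check on generators alone that a homomorphism maps a generated field into
  \<open>L\<close>.\<close>

lemma is_subfield_vimage:
  assumes "is_subfield L"
  shows "is_subfield {x \<in> K. \<phi> x \<in> L}"
  using subfield_closed[OF K] subfield_closed[OF assms] hom_simps
  by (auto simp: is_subfield_def)

end

text \<open>The reason why two homomorphisms that agree on generators agree on the generated
  field.\<close>

lemma is_subfield_equalizer:
  assumes K: "is_subfield K" and hom: "field_hom_on K \<phi>" "field_hom_on K \<psi>"
  shows "is_subfield {x \<in> K. \<phi> x = \<psi> x}"
  using subfield_closed[OF K] hom_simps[OF K hom(1)] hom_simps[OF K hom(2)]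
  by (auto simp: is_subfield_def)

lemma hom_Rats:
  fixes \<phi> :: "'a::field_char_0 \<Rightarrow> 'a"
  assumes "is_subfield K" "field_hom_on K \<phi>" "x \<in> \<rat>"
  shows "\<phi> x = x"
proof -
  obtain m n :: int where "x = of_int m / of_int n"
    using assms(3) by (metis Rats_cases' of_int_def)
  then show ?thesis
    using assms by (simp add: hom_divide hom_of_int subfield_of_int)
qed

subsection \<open>Adjoining square roots and cube roots\<close>

definition adjoin_sqrt :: "'a::field set \<Rightarrow> 'a \<Rightarrow> 'a set"
  where "adjoin_sqrt K z = {x + y * z | x y. x \<in> K \<and> y \<in> K}"

definition adjoin_cbrt :: "'a::field set \<Rightarrow> 'a \<Rightarrow> 'a set"
  where "adjoin_cbrt K z = {x + y * z + w * z ^ 2 | x y w. x \<in> K \<and> y \<in> K \<and> w \<in> K}"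

section \<open>Quadratic extensions\<close>

context
  fixes K :: "'a::field set" and z :: 'a
  assumes K: "is_subfield K" and z: "z \<notin> K" "z ^ 2 \<in> K"
begin

lemma adjoin_sqrt_eq_0_iff:
  assumes "x \<in> K" "y \<in> K"
  shows "x + y * z = 0 \<longleftrightarrow> x = 0 \<and> y = 0"
proof
  assume eq: "x + y * z = 0"
  show "x = 0 \<and> y = 0"
  proof (cases "y = 0")
    case False
    then have "z = - x / y"
      using eq by (simp add: field_simps eq_neg_iff_add_eq_0)
    then have "z \<in> K"
      using assms subfield_closed[OF K] by metis
    with z show ?thesis by blast
  qed (use eq in simp)
qed simp

lemma adjoin_sqrt_unique:
  assumes "x \<in> K" "y \<in> K" "x' \<in> K" "y' \<in> K" "x + y * z = x' + y' * z"
  shows "x = x'" "y = y'"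
proof -
  have "(x - x') + (y - y') * z = 0"
    using assms by (simp add: algebra_simps)
  then show "x = x'" "y = y'"
    using adjoin_sqrt_eq_0_iff[of "x - x'" "y - y'"] assms subfield_diff[OF K] by auto
qed

lemma subset_adjoin_sqrt: "K \<subseteq> adjoin_sqrt K z"
  using subfield_0[OF K] by (force simp: adjoin_sqrt_def)

lemma in_adjoin_sqrt: "z \<in> adjoin_sqrt K z"
  using subfield_0[OF K] subfield_1[OF K] by (force simp: adjoin_sqrt_def)

lemma adjoin_sqrt_mult:
  "(x + y * z) * (x' + y' * z) = (x * x' + y * y' * z ^ 2) + (x * y' + y * x') * z"
  by (simp add: algebra_simps power2_eq_square)

lemma is_subfield_adjoin_sqrt: "is_subfield (adjoin_sqrt K z)"
proof -
  have I: "x + y * z \<in> adjoin_sqrt K z" if "x \<in> K" "y \<in> K" for x y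
    using that by (auto simp: adjoin_sqrt_def)
  show ?thesis
    unfolding is_subfield_def
  proof (intro conjI ballI)
    show "1 \<in> adjoin_sqrt K z"
      using subset_adjoin_sqrt subfield_1[OF K] by blast
  next
    fix v assume "v \<in> adjoin_sqrt K z"
    then obtain x y where v: "v = x + y * z" "x \<in> K" "y \<in> K"
      by (auto simp: adjoin_sqrt_def)
    show "- v \<in> adjoin_sqrt K z"
      using I[of "- x" "- y"] v subfield_uminus[OF K] by simp
    \<comment> \<open>The norm of \<open>v\<close>, its product with the conjugate
      \<open>x - y * z\<close>; independence of 1 and \<open>z\<close> keeps the conjugate, hence
      the norm, away from 0.\<close>
    define N where "N = x ^ 2 - y ^ 2 * z ^ 2"
    have N: "N \<in> K"
      unfolding N_def using v z by (auto intro!: subfield_closed[OF K])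
    have eq: "v * (x - y * z) = N"
      by (simp add: N_def v algebra_simps power2_eq_square)
    show "inverse v \<in> adjoin_sqrt K z"
    proof (cases "v = 0")
      case False
      have "x + (- y) * z \<noteq> 0"
        using adjoin_sqrt_eq_0_iff[of x "- y"] v False subfield_uminus[OF K] by auto
      with False eq have "N \<noteq> 0" by auto
      then have "inverse v = x / N + (- y / N) * z"
        using eq False by (simp add: field_simps)
      then show ?thesis
        using I[of "x / N" "- y / N"] v N subfield_closed[OF K] by auto
    qed (use v I[of 0 0] subfield_0[OF K] in auto)
    fix v' assume "v' \<in> adjoin_sqrt K z"
    then obtain x' y' where v': "v' = x' + y' * z" "x' \<in> K" "y' \<in> K"
      by (auto simp: adjoin_sqrt_def)
    have "v + v' = (x + x') + (y + y') * z"
      by (simp add: v v' algebra_simps)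
    also have "\<dots> \<in> adjoin_sqrt K z"
      using v v' by (intro I subfield_add[OF K])
    finally show "v + v' \<in> adjoin_sqrt K z" .
    show "v * v' \<in> adjoin_sqrt K z"
      unfolding v v' adjoin_sqrt_mult using v v' z(2)
      by (intro I subfield_add[OF K] subfield_mult[OF K])
  qed
qed

text \<open>Coordinates with respect to 1 and \<open>z\<close> are unique, so applying
  \<open>\<phi>\<close> to them and replacing \<open>z\<close> by \<open>y\<close> is well defined.
  Products only use the relation for \<open>z ^ 2\<close>, which \<open>y\<close> satisfies after
  applying \<open>\<phi>\<close>.\<close>

lemma hom_extend_sqrt:
  fixes \<phi> :: "'a \<Rightarrow> 'b::field"
  assumes \<phi>: "field_hom_on K \<phi>" and y: "y ^ 2 = \<phi> (z ^ 2)"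
  obtains \<psi> where "field_hom_on (adjoin_sqrt K z) \<psi>" "\<And>x. x \<in> K \<Longrightarrow> \<psi> x = \<phi> x" "\<psi> z = y"
proof -
  define P where "P v q \<longleftrightarrow> fst q \<in> K \<and> snd q \<in> K \<and> v = fst q + snd q * z" for v and q :: "'a \<times> 'a"
  define \<psi> where "\<psi> v = (let q = SOME q. P v q in \<phi> (fst q) + \<phi> (snd q) * y)" for v
  have eq: "\<psi> (x1 + x2 * z) = \<phi> x1 + \<phi> x2 * y" if "x1 \<in> K" "x2 \<in> K" for x1 x2
  proof -
    have "(SOME q. P (x1 + x2 * z) q) = (x1, x2)"
    proof (rule some_equality)
      fix q assume "P (x1 + x2 * z) q"
      then show "q = (x1, x2)"
        using adjoin_sqrt_unique[of x1 x2 "fst q" "snd q"] that by (auto simp: P_def prod_eq_iff)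
    qed (use that in \<open>simp add: P_def\<close>)
    then show ?thesis
      by (simp add: \<psi>_def)
  qed
  have K': "\<psi> x = \<phi> x" if "x \<in> K" for x
    using eq[of x 0] that subfield_0[OF K] hom_0[OF K \<phi>] by simp
  show thesis
  proof
    show "field_hom_on (adjoin_sqrt K z) \<psi>"
      unfolding field_hom_on_def
    proof (intro conjI ballI)
      fix v v' assume "v \<in> adjoin_sqrt K z" "v' \<in> adjoin_sqrt K z"
      then obtain x1 x2 x1' x2' where v: "v = x1 + x2 * z" "x1 \<in> K" "x2 \<in> K"
          "v' = x1' + x2' * z" "x1' \<in> K" "x2' \<in> K"
        by (auto simp: adjoin_sqrt_def)
      have "\<psi> (v + v') = \<psi> ((x1 + x1') + (x2 + x2') * z)"
        by (simp add: v algebra_simps)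
      also have "\<dots> = \<phi> (x1 + x1') + \<phi> (x2 + x2') * y"
        using v by (intro eq subfield_add[OF K])
      also have "\<dots> = (\<phi> x1 + \<phi> x2 * y) + (\<phi> x1' + \<phi> x2' * y)"
        using v by (simp add: hom_add[OF K \<phi>] algebra_simps)
      also have "\<dots> = \<psi> v + \<psi> v'"
        using v by (simp only: eq)
      finally show "\<psi> (v + v') = \<psi> v + \<psi> v'" .
      have "\<psi> (v * v') = \<phi> (x1 * x1' + x2 * x2' * z ^ 2) + \<phi> (x1 * x2' + x2 * x1') * y"
        unfolding v adjoin_sqrt_mult using v z subfield_closed[OF K] by (intro eq) auto
      also have "\<dots> = (\<phi> x1 * \<phi> x1' + \<phi> x2 * \<phi> x2' * y ^ 2) + (\<phi> x1 * \<phi> x2' + \<phi> x2 * \<phi> x1') * y"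
        unfolding y using v z by (simp add: hom_simps[OF K \<phi>] subfield_closed[OF K])
      also have "\<dots> = (\<phi> x1 + \<phi> x2 * y) * (\<phi> x1' + \<phi> x2' * y)"
        by (simp add: algebra_simps power2_eq_square)
      also have "\<dots> = \<psi> v * \<psi> v'"
        using v by (simp only: eq)
      finally show "\<psi> (v * v') = \<psi> v * \<psi> v'" .
    qed (simp add: K' subfield_1[OF K] hom_1[OF K \<phi>])
    show "\<psi> z = y"
      using eq[of 0 1] subfield_0[OF K] subfield_1[OF K] by (simp add: hom_0[OF K \<phi>] hom_1[OF K \<phi>])
  qed (fact K')
qed

text \<open>The \<open>z\<close>-coordinate of \<open>(p + q * z) ^ 3\<close> is
  \<open>q * (3 * p ^ 2 + q ^ 2 * z ^ 2)\<close> and must vanish. Either \<open>q = 0\<close> and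
  \<open>x\<close> lies in \<open>K\<close>, or \<open>q ^ 2 * z ^ 2 = - 3 * p ^ 2\<close> and the
  cube collapses to \<open>(- 2 * p) ^ 3\<close>.\<close>

lemma cube_descends_sqrt:
  assumes x: "x \<in> adjoin_sqrt K z" "x ^ 3 \<in> K"
  shows "\<exists>y\<in>K. y ^ 3 = x ^ 3"
proof -
  obtain p q where pq: "p \<in> K" "q \<in> K" "x = p + q * z"
    using x by (auto simp: adjoin_sqrt_def)
  have eq: "x ^ 3 = (p ^ 3 + 3 * p * q ^ 2 * z ^ 2) + (3 * p ^ 2 * q + q ^ 3 * z ^ 2) * z"
    by (simp add: pq algebra_simps power2_eq_square power3_eq_cube)
  have in_K: "p ^ 3 + 3 * p * q ^ 2 * z ^ 2 \<in> K" "3 * p ^ 2 * q + q ^ 3 * z ^ 2 \<in> K"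
    using pq z by (auto intro!: subfield_closed[OF K])
  have zero: "0 = 3 * p ^ 2 * q + q ^ 3 * z ^ 2"
    using adjoin_sqrt_unique(2)[OF x(2) subfield_0[OF K] in_K] eq by simp
  also have "\<dots> = q * (3 * p ^ 2 + q ^ 2 * z ^ 2)"
    by (simp add: algebra_simps power2_eq_square power3_eq_cube)
  finally consider "q = 0" | "q ^ 2 * z ^ 2 = - 3 * p ^ 2"
    by (auto simp: eq_neg_iff_add_eq_0 add.commute)
  then show ?thesis
  proof cases
    case 1
    then show ?thesis using pq by auto
  next
    case 2
    have "x ^ 3 = p ^ 3 + 3 * p * (q ^ 2 * z ^ 2)"
      using eq unfolding zero [symmetric] by (simp add: mult.assoc)
    also have "\<dots> = (- 2 * p) ^ 3"
      unfolding 2 by (simp add: power2_eq_square power3_eq_cube algebra_simps)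
    finally show ?thesis
      using pq subfield_closed[OF K] by (metis)
  qed
qed

end

section \<open>Pure cubic extensions\<close>

context
  fixes K :: "'a::field set" and z :: 'a
  assumes K: "is_subfield K" and z: "z ^ 3 \<in> K" "\<forall>x\<in>K. x ^ 3 \<noteq> z ^ 3"
begin

lemma cbrt_notin: "z \<notin> K"
  using z by blast

text \<open>A relation \<open>z ^ 2 = p + q * z\<close> gives
  \<open>z ^ 3 = p * q + (p + q ^ 2) * z\<close>. As \<open>z\<close> is not in \<open>K\<close>,
  this forces \<open>p = - (q ^ 2)\<close> and \<open>z ^ 3 = (- q) ^ 3\<close>, although
  \<open>z ^ 3\<close> is no cube in \<open>K\<close>.\<close>

lemma adjoin_cbrt_eq_0_iff:
  assumes x: "x0 \<in> K" "x1 \<in> K" "x2 \<in> K"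
  shows "x0 + x1 * z + x2 * z ^ 2 = 0 \<longleftrightarrow> x0 = 0 \<and> x1 = 0 \<and> x2 = 0"
proof
  assume eq: "x0 + x1 * z + x2 * z ^ 2 = 0"
  have lin: "p = 0 \<and> q = 0" if "p \<in> K" "q \<in> K" "p + q * z = 0" for p q
  proof (rule ccontr)
    assume "\<not> (p = 0 \<and> q = 0)"
    with that have "q \<noteq> 0" by auto
    with that have "z = - p / q"
      by (simp add: field_simps eq_neg_iff_add_eq_0)
    then show False
      using that cbrt_notin by (auto intro!: subfield_closed[OF K])
  qed
  show "x0 = 0 \<and> x1 = 0 \<and> x2 = 0"
  proof (cases "x2 = 0")
    case False
    define p q where "p = - x0 / x2" and "q = - x1 / x2"
    have pq: "p \<in> K" "q \<in> K"
      unfolding p_def q_def by (auto intro!: subfield_closed[OF K] x)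
    have "x0 + x1 * z = - (x2 * z ^ 2)"
      using eq by (simp add: eq_neg_iff_add_eq_0)
    then have "- (x0 + x1 * z) / x2 = z ^ 2"
      using False by simp
    then have sq: "z ^ 2 = p + q * z"
      by (simp add: p_def q_def add_divide_distrib diff_divide_distrib)
    have "z ^ 3 = z * z ^ 2"
      by (simp add: power2_eq_square power3_eq_cube)
    also have "\<dots> = z * (p + q * z)"
      by (simp only: sq)
    also have "\<dots> = p * z + q * z ^ 2"
      by (simp add: power2_eq_square algebra_simps)
    also have "\<dots> = p * q + (p + q ^ 2) * z"
      unfolding sq by (simp add: algebra_simps power2_eq_square)
    finally have cube: "z ^ 3 = p * q + (p + q ^ 2) * z" .
    have "p * q - z ^ 3 \<in> K" "p + q ^ 2 \<in> K"
      using pq z(1) by (auto intro: subfield_closed[OF K])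
    then have "p * q - z ^ 3 = 0 \<and> p + q ^ 2 = 0"
      using cube by (intro lin) auto
    then have "z ^ 3 = p * q" "p = - (q ^ 2)"
      by (simp_all add: eq_neg_iff_add_eq_0)
    then have "z ^ 3 = (- q) ^ 3"
      by (simp add: power2_eq_square power3_eq_cube)
    then show ?thesis
      using z(2) pq subfield_uminus[OF K] by metis
  qed (use lin[of x0 x1] eq x in auto)
qed simp

lemma adjoin_cbrt_unique:
  assumes "x0 \<in> K" "x1 \<in> K" "x2 \<in> K" "y0 \<in> K" "y1 \<in> K" "y2 \<in> K"
    and "x0 + x1 * z + x2 * z ^ 2 = y0 + y1 * z + y2 * z ^ 2"
  shows "x0 = y0" "x1 = y1" "x2 = y2"
proof -
  have "(x0 - y0) + (x1 - y1) * z + (x2 - y2) * z ^ 2 = 0"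
    using assms by (simp add: algebra_simps)
  then show "x0 = y0" "x1 = y1" "x2 = y2"
    using adjoin_cbrt_eq_0_iff[of "x0 - y0" "x1 - y1" "x2 - y2"] assms subfield_diff[OF K] by auto
qed

lemma subset_adjoin_cbrt: "K \<subseteq> adjoin_cbrt K z"
  using subfield_0[OF K] by (force simp: adjoin_cbrt_def)

lemma in_adjoin_cbrt: "z \<in> adjoin_cbrt K z"
  using subfield_0[OF K] subfield_1[OF K] by (force simp: adjoin_cbrt_def)

lemma adjoin_cbrt_mult:
  "(x0 + x1 * z + x2 * z ^ 2) * (y0 + y1 * z + y2 * z ^ 2) =
    (x0 * y0 + z ^ 3 * (x1 * y2 + x2 * y1)) + (x0 * y1 + x1 * y0 + z ^ 3 * (x2 * y2)) * z
    + (x0 * y2 + x1 * y1 + x2 * y0) * z ^ 2"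
  by (simp add: algebra_simps power2_eq_square power3_eq_cube)

lemma is_subfield_adjoin_cbrt: "is_subfield (adjoin_cbrt K z)"
proof -
  have I: "x0 + x1 * z + x2 * z ^ 2 \<in> adjoin_cbrt K z" if "x0 \<in> K" "x1 \<in> K" "x2 \<in> K" for x0 x1 x2
    using that by (auto simp: adjoin_cbrt_def)
  show ?thesis
    unfolding is_subfield_def
  proof (intro conjI ballI)
    show "1 \<in> adjoin_cbrt K z"
      using subset_adjoin_cbrt subfield_1[OF K] by blast
  next
    fix v assume "v \<in> adjoin_cbrt K z"
    then obtain x0 x1 x2 where v: "v = x0 + x1 * z + x2 * z ^ 2" and x: "x0 \<in> K" "x1 \<in> K" "x2 \<in> K"
      by (auto simp: adjoin_cbrt_def)
    show "- v \<in> adjoin_cbrt K z"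
      using I[of "- x0" "- x1" "- x2"] v x subfield_uminus[OF K] by simp
    define c where "c = z ^ 3"
    have c: "c \<in> K"
      using z by (simp add: c_def)
    \<comment> \<open>The norm form of the pure cubic extension; \<open>y0\<close>,
      \<open>y1\<close>, \<open>y2\<close> are the coordinates of the product of the other two
      conjugates of \<open>v\<close>.\<close>
    define N where "N = x0 ^ 3 + c * x1 ^ 3 + c ^ 2 * x2 ^ 3 - 3 * c * x0 * x1 * x2"
    define y0 y1 y2 where "y0 = x0 ^ 2 - c * (x1 * x2)" and "y1 = c * x2 ^ 2 - x0 * x1"
      and "y2 = x1 ^ 2 - x0 * x2"
    have y: "y0 \<in> K" "y1 \<in> K" "y2 \<in> K" "N \<in> K"
      unfolding y0_def y1_def y2_def N_def by (auto intro!: subfield_closed[OF K] x c)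
    have eq: "v * (y0 + y1 * z + y2 * z ^ 2) = N"
      unfolding v adjoin_cbrt_mult c_def [symmetric]
      by (simp add: N_def y0_def y1_def y2_def algebra_simps power2_eq_square power3_eq_cube)
    show "inverse v \<in> adjoin_cbrt K z"
    proof (cases "v = 0")
      case False
      \<comment> \<open>If \<open>N = 0\<close>, all three \<open>y\<close> coordinates vanish. For
        \<open>x2 \<noteq> 0\<close> this makes \<open>c\<close> the cube of \<open>x1 / x2\<close>;
        for \<open>x2 = 0\<close> it makes \<open>x0\<close> and \<open>x1\<close> vanish too, so
        \<open>v = 0\<close>.\<close>
      have "N \<noteq> 0"
      proof
        assume "N = 0"
        with False eq have "y0 + y1 * z + y2 * z ^ 2 = 0" by simp
        then have *: "y0 = 0" "y1 = 0" "y2 = 0"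
          using adjoin_cbrt_eq_0_iff y by blast+
        show False
        proof (cases "x2 = 0")
          case True
          with * False v show False
            by (simp add: y0_def y2_def)
        next
          case x2: False
          have "x1 ^ 3 = x1 * x1 ^ 2"
            by (simp add: power2_eq_square power3_eq_cube)
          also have "\<dots> = x2 * (x0 * x1)"
            using *(3) by (simp add: y2_def)
          also have "\<dots> = c * x2 ^ 3"
            using *(2) by (simp add: y1_def power2_eq_square power3_eq_cube)
          finally have "(x1 / x2) ^ 3 = c"
            using x2 by (simp add: power_divide)
          then show False
            using z(2) x subfield_divide[OF K] by (metis c_def)
        qed
      qed
      then have "inverse v = (y0 + y1 * z + y2 * z ^ 2) / N"
        using eq False by (metis inverse_eq_divide nonzero_mult_div_cancel_left
          divide_divide_eq_left' divide_self mult.commute)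
      also have "\<dots> = y0 / N + (y1 / N) * z + (y2 / N) * z ^ 2"
        by (simp add: add_divide_distrib)
      finally have "inverse v = y0 / N + (y1 / N) * z + (y2 / N) * z ^ 2" .
      then show ?thesis
        using I[of "y0 / N" "y1 / N" "y2 / N"] y subfield_divide[OF K] by auto
    qed (use I[of 0 0 0] subfield_0[OF K] in auto)
    fix v' assume "v' \<in> adjoin_cbrt K z"
    then obtain x0' x1' x2' where v': "v' = x0' + x1' * z + x2' * z ^ 2"
      and x': "x0' \<in> K" "x1' \<in> K" "x2' \<in> K"
      by (auto simp: adjoin_cbrt_def)
    have "v + v' = (x0 + x0') + (x1 + x1') * z + (x2 + x2') * z ^ 2"
      by (simp add: v v' algebra_simps)
    also have "\<dots> \<in> adjoin_cbrt K z"
      using x x' by (intro I subfield_add[OF K])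
    finally show "v + v' \<in> adjoin_cbrt K z" .
    show "v * v' \<in> adjoin_cbrt K z"
      unfolding v v' adjoin_cbrt_mult using x x' z(1)
      by (intro I subfield_add[OF K] subfield_mult[OF K])
  qed
qed

text \<open>As for square roots: coordinates are unique, and the product formula only uses the value
  of \<open>z ^ 3\<close>, which \<open>\<phi>\<close> sends to \<open>y ^ 3\<close>.\<close>

lemma hom_extend_cbrt:
  fixes \<phi> :: "'a \<Rightarrow> 'b::field"
  assumes \<phi>: "field_hom_on K \<phi>" and y: "y ^ 3 = \<phi> (z ^ 3)"
  obtains \<psi> where "field_hom_on (adjoin_cbrt K z) \<psi>" "\<And>x. x \<in> K \<Longrightarrow> \<psi> x = \<phi> x" "\<psi> z = y"
proof -
  define P where "P v q \<longleftrightarrow> (case q of (x0, x1, x2) \<Rightarrow>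
    x0 \<in> K \<and> x1 \<in> K \<and> x2 \<in> K \<and> v = x0 + x1 * z + x2 * z ^ 2)" for v q
  define \<psi> where "\<psi> v = (case SOME q. P v q of (x0, x1, x2) \<Rightarrow> \<phi> x0 + \<phi> x1 * y + \<phi> x2 * y ^ 2)" for v
  have eq: "\<psi> (x0 + x1 * z + x2 * z ^ 2) = \<phi> x0 + \<phi> x1 * y + \<phi> x2 * y ^ 2"
    if "x0 \<in> K" "x1 \<in> K" "x2 \<in> K" for x0 x1 x2
  proof -
    have "(SOME q. P (x0 + x1 * z + x2 * z ^ 2) q) = (x0, x1, x2)"
    proof (rule some_equality)
      fix q assume "P (x0 + x1 * z + x2 * z ^ 2) q"
      then obtain y0 y1 y2 where "q = (y0, y1, y2)" "y0 \<in> K" "y1 \<in> K" "y2 \<in> K"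
        "x0 + x1 * z + x2 * z ^ 2 = y0 + y1 * z + y2 * z ^ 2"
        by (cases q) (auto simp: P_def)
      then show "q = (x0, x1, x2)"
        using adjoin_cbrt_unique[of x0 x1 x2 y0 y1 y2] that by auto
    qed (use that in \<open>simp add: P_def\<close>)
    then show ?thesis
      by (simp add: \<psi>_def)
  qed
  have K': "\<psi> x = \<phi> x" if "x \<in> K" for x
    using eq[of x 0 0] that subfield_0[OF K] hom_0[OF K \<phi>] by simp
  show thesis
  proof
    show "field_hom_on (adjoin_cbrt K z) \<psi>"
      unfolding field_hom_on_def
    proof (intro conjI ballI)
      fix v v' assume "v \<in> adjoin_cbrt K z" "v' \<in> adjoin_cbrt K z"
      then obtain x0 x1 x2 x0' x1' x2' where v: "v = x0 + x1 * z + x2 * z ^ 2"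
        "v' = x0' + x1' * z + x2' * z ^ 2"
        and x: "x0 \<in> K" "x1 \<in> K" "x2 \<in> K" "x0' \<in> K" "x1' \<in> K" "x2' \<in> K"
        by (auto simp: adjoin_cbrt_def)
      have "\<psi> (v + v') = \<psi> ((x0 + x0') + (x1 + x1') * z + (x2 + x2') * z ^ 2)"
        by (simp add: v algebra_simps)
      also have "\<dots> = \<phi> (x0 + x0') + \<phi> (x1 + x1') * y + \<phi> (x2 + x2') * y ^ 2"
        using x by (intro eq subfield_add[OF K])
      also have "\<dots> = (\<phi> x0 + \<phi> x1 * y + \<phi> x2 * y ^ 2) + (\<phi> x0' + \<phi> x1' * y + \<phi> x2' * y ^ 2)"
        using x by (simp add: hom_add[OF K \<phi>] algebra_simps)
      also have "\<dots> = \<psi> v + \<psi> v'"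
        unfolding v using x by (simp only: eq)
      finally show "\<psi> (v + v') = \<psi> v + \<psi> v'" .
      have "\<psi> (v * v') = \<phi> (x0 * x0' + z ^ 3 * (x1 * x2' + x2 * x1'))
          + \<phi> (x0 * x1' + x1 * x0' + z ^ 3 * (x2 * x2')) * y
          + \<phi> (x0 * x2' + x1 * x1' + x2 * x0') * y ^ 2"
        unfolding v adjoin_cbrt_mult using x z(1)
        by (intro eq subfield_add[OF K] subfield_mult[OF K])
      also have "\<dots> = (\<phi> x0 * \<phi> x0' + y ^ 3 * (\<phi> x1 * \<phi> x2' + \<phi> x2 * \<phi> x1'))
          + (\<phi> x0 * \<phi> x1' + \<phi> x1 * \<phi> x0' + y ^ 3 * (\<phi> x2 * \<phi> x2')) * y
          + (\<phi> x0 * \<phi> x2' + \<phi> x1 * \<phi> x1' + \<phi> x2 * \<phi> x0') * y ^ 2"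
        unfolding y using x z(1)
        by (simp add: hom_add[OF K \<phi>] hom_mult[OF K \<phi>] subfield_add[OF K] subfield_mult[OF K])
      also have "\<dots> = (\<phi> x0 + \<phi> x1 * y + \<phi> x2 * y ^ 2) * (\<phi> x0' + \<phi> x1' * y + \<phi> x2' * y ^ 2)"
        by (simp add: algebra_simps power2_eq_square power3_eq_cube)
      also have "\<dots> = \<psi> v * \<psi> v'"
        unfolding v using x by (simp only: eq)
      finally show "\<psi> (v * v') = \<psi> v * \<psi> v'" .
    qed (simp add: K' subfield_1[OF K] hom_1[OF K \<phi>])
    show "\<psi> z = y"
      using eq[of 0 1 0] subfield_0[OF K] subfield_1[OF K]
      by (simp add: hom_0[OF K \<phi>] hom_1[OF K \<phi>])
  qed (fact K')
qed

text \<open>The cubic case of Kummer theory: the elements of \<open>K\<close> that become cubes are,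
  up to cubes of \<open>K\<close>, powers of \<open>z ^ 3\<close>. The mixed coordinates of
  \<open>x ^ 3\<close> vanish, which forces \<open>x\<close> to be a single term \<open>x0\<close>,
  \<open>x1 * z\<close> or \<open>x2 * z ^ 2\<close>; \<open>char\<close> serves to cancel the
  factor 3.\<close>

lemma cube_in_adjoin_cbrt:
  assumes x: "x \<in> adjoin_cbrt K z" "x ^ 3 \<in> K" and char: "(3::'a) \<noteq> 0"
  obtains y where "y \<in> K" "x ^ 3 = y ^ 3 \<or> x ^ 3 = y ^ 3 * z ^ 3 \<or> x ^ 3 = y ^ 3 * (z ^ 3) ^ 2"
proof -
  obtain x0 x1 x2 where xs: "x0 \<in> K" "x1 \<in> K" "x2 \<in> K" and x_eq: "x = x0 + x1 * z + x2 * z ^ 2"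
    using x by (auto simp: adjoin_cbrt_def)
  define c where "c = z ^ 3"
  define B C where "B = 3 * (x0 ^ 2 * x1 + c * x1 ^ 2 * x2 + c * x0 * x2 ^ 2)"
    and "C = 3 * (x0 * x1 ^ 2 + x0 ^ 2 * x2 + c * x1 * x2 ^ 2)"
  define A where "A = x0 ^ 3 + c * x1 ^ 3 + c ^ 2 * x2 ^ 3 + 6 * c * x0 * x1 * x2"
  have cube: "x ^ 3 = A + B * z + C * z ^ 2"
    unfolding x_eq A_def B_def C_def c_def
    by (simp add: algebra_simps power2_eq_square power3_eq_cube)
  have c: "c \<in> K"
    using z by (simp add: c_def)
  have ABC: "A \<in> K" "B \<in> K" "C \<in> K"
    unfolding A_def B_def C_def by (auto intro!: subfield_closed[OF K] xs c)
  have "A + B * z + C * z ^ 2 = x ^ 3 + 0 * z + 0 * z ^ 2"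
    using cube by simp
  note * = adjoin_cbrt_unique(2,3)[OF ABC x(2) subfield_0[OF K] subfield_0[OF K] this]
  from * have BC: "x0 ^ 2 * x1 + c * x1 ^ 2 * x2 + c * x0 * x2 ^ 2 = 0"
    "x0 * x1 ^ 2 + x0 ^ 2 * x2 + c * x1 * x2 ^ 2 = 0"
    using char unfolding B_def C_def mult_eq_0_iff by blast+
  define u0 u1 u2 where "u0 = x0" and "u1 = x1 * z" and "u2 = x2 * z ^ 2"
  have "u0 ^ 2 * u1 + u1 ^ 2 * u2 + u2 ^ 2 * u0 = z * (x0 ^ 2 * x1 + c * x1 ^ 2 * x2 + c * x0 * x2 ^ 2)"
    by (simp add: u0_def u1_def u2_def c_def algebra_simps power2_eq_square power3_eq_cube)
  then have E1: "u0 ^ 2 * u1 + u1 ^ 2 * u2 + u2 ^ 2 * u0 = 0"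
    unfolding BC by simp
  have "u0 * u1 ^ 2 + u0 ^ 2 * u2 + u1 * u2 ^ 2 = z ^ 2 * (x0 * x1 ^ 2 + x0 ^ 2 * x2 + c * x1 * x2 ^ 2)"
    by (simp add: u0_def u1_def u2_def c_def algebra_simps power2_eq_square power3_eq_cube)
  then have E2: "u0 * u1 ^ 2 + u0 ^ 2 * u2 + u1 * u2 ^ 2 = 0"
    unfolding BC by simp
  \<comment> \<open>The two vanishing cyclic sums differ by the Vandermonde product of
    \<open>u0\<close>, \<open>u1\<close>, \<open>u2\<close>. So two of these terms agree, and by
    linear independence both are 0.\<close>
  have "(u0 - u1) * (u1 - u2) * (u2 - u0) =
      (u0 * u1 ^ 2 + u0 ^ 2 * u2 + u1 * u2 ^ 2) - (u0 ^ 2 * u1 + u1 ^ 2 * u2 + u2 ^ 2 * u0)"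
    by (simp add: algebra_simps power2_eq_square)
  then have "(u0 - u1) * (u1 - u2) * (u2 - u0) = 0"
    unfolding E1 E2 by simp
  then consider "u0 = u1" | "u1 = u2" | "u2 = u0"
    by auto
  then have two: "x0 = 0 \<and> x1 = 0 \<or> x1 = 0 \<and> x2 = 0 \<or> x0 = 0 \<and> x2 = 0"
  proof cases
    case 1
    then show ?thesis
      using adjoin_cbrt_eq_0_iff[of x0 "- x1" 0] xs subfield_0[OF K] subfield_uminus[OF K]
      by (auto simp: u0_def u1_def)
  next
    case 2
    then show ?thesis
      using adjoin_cbrt_eq_0_iff[of 0 x1 "- x2"] xs subfield_0[OF K] subfield_uminus[OF K]
      by (auto simp: u1_def u2_def)
  next
    case 3
    then show ?thesis
      using adjoin_cbrt_eq_0_iff[of x0 0 "- x2"] xs subfield_0[OF K] subfield_uminus[OF K]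
      by (auto simp: u0_def u2_def)
  qed
  have "x2 ^ 3 * (z ^ 2) ^ 3 = x2 ^ 3 * (z ^ 3) ^ 2"
    by (simp flip: power_mult)
  with two that xs show thesis
    unfolding x_eq by (auto simp: power_mult_distrib)
qed

end

subsection \<open>Splitting fields and Galois groups\<close>

abbreviation rat_roots :: "rat poly \<Rightarrow> complex set"
  where "rat_roots p \<equiv> {z. poly (map_poly of_rat p) z = 0}"

lemma ring_of_type_algebra_simps:
  fixes x y :: "'a::field"
  shows "\<one>\<^bsub>ring_of_type_algebra :: 'a ring\<^esub> = 1" "\<zero>\<^bsub>ring_of_type_algebra :: 'a ring\<^esub> = 0"
    "x \<oplus>\<^bsub>ring_of_type_algebra\<^esub> y = x + y" "x \<otimes>\<^bsub>ring_of_type_algebra\<^esub> y = x * y"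
    "\<ominus>\<^bsub>ring_of_type_algebra\<^esub> x = - x"
    "x \<noteq> 0 \<Longrightarrow> inv\<^bsub>ring_of_type_algebra\<^esub> x = inverse x"
proof -
  let ?R = "ring_of_type_algebra :: 'a ring"
  interpret field ?R
    by (rule field_from_type_algebra)
  show *: "\<one>\<^bsub>?R\<^esub> = 1" "\<zero>\<^bsub>?R\<^esub> = 0" "x \<oplus>\<^bsub>?R\<^esub> y = x + y" "x \<otimes>\<^bsub>?R\<^esub> y = x * y" for x y
    by (auto simp: ring_of_type_algebra_def)
  have carrier: "carrier ?R = UNIV"
    by (simp add: ring_of_type_algebra_def)
  have "- x \<oplus>\<^bsub>?R\<^esub> x = \<zero>\<^bsub>?R\<^esub>"
    by (simp add: *)
  then show "\<ominus>\<^bsub>?R\<^esub> x = - x"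
    by (intro minus_equality) (auto simp: carrier)
  show "inv\<^bsub>?R\<^esub> x = inverse x" if "x \<noteq> 0"
    using that by (intro comm_inv_char) (auto simp: carrier *)
qed

lemma is_subfield_generate_field:
  fixes H :: "'a::field set"
  shows "is_subfield (generate_field ring_of_type_algebra H)"
  unfolding is_subfield_def
proof (intro conjI ballI)
  let ?R = "ring_of_type_algebra :: 'a ring"
  have one: "1 \<in> generate_field ?R H"
    using generate_field.one[of ?R H] by (simp add: ring_of_type_algebra_simps)
  then show "1 \<in> generate_field ?R H" .
  fix x assume x: "x \<in> generate_field ?R H"
  show neg: "- x \<in> generate_field ?R H" if "x \<in> generate_field ?R H" for x
    using generate_field.a_inv[OF that] by (simp add: ring_of_type_algebra_simps)
  show add: "x + y \<in> generate_field ?R H" if "x \<in> generate_field ?R H" "y \<in> generate_field ?R H" for x y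
    using generate_field.eng_add[OF that] by (simp add: ring_of_type_algebra_simps)
  show "x * y \<in> generate_field ?R H" if "x \<in> generate_field ?R H" "y \<in> generate_field ?R H" for x y
    using generate_field.eng_mult[OF that] by (simp add: ring_of_type_algebra_simps)
  show "inverse x \<in> generate_field ?R H"
  proof (cases "x = 0")
    case True
    then show ?thesis
      using add[OF one neg[OF one]] by simp
  next
    case False
    then show ?thesis
      using generate_field.m_inv[OF x] by (simp add: ring_of_type_algebra_simps)
  qed
qed

lemma generate_field_subset:
  fixes H :: "'a::field set"
  assumes K: "is_subfield K" and "H \<subseteq> K"
  shows "generate_field ring_of_type_algebra H \<subseteq> K"
proof
  fix x assume "x \<in> generate_field ring_of_type_algebra H"
  then show "x \<in> K"
    by induction (use assms in \<open>auto simp: ring_of_type_algebra_simps intro: subfield_closed[OF K]\<close>)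
qed

lemma is_subfield_splitting_field: "is_subfield (carrier (splitting_field p))"
  by (simp add: splitting_field_def is_subfield_generate_field)

lemma roots_subset_splitting_field: "rat_roots p \<subseteq> carrier (splitting_field p)"
  by (auto simp: splitting_field_def intro: generate_field.incl)

lemma splitting_field_subset:
  assumes "is_subfield K" "rat_roots p \<subseteq> K"
  shows "carrier (splitting_field p) \<subseteq> K"
  using generate_field_subset[OF assms(1), of "\<rat> \<union> rat_roots p"] assms Rats_subset_subfield[OF assms(1)]
  by (auto simp: splitting_field_def)

text \<open>Rational coefficients are fixed, so roots of \<open>p\<close> are mapped to roots of
  \<open>p\<close>.\<close>

lemma hom_poly_rat:
  fixes \<phi> :: "complex \<Rightarrow> complex"
  assumes K: "is_subfield K" and \<phi>: "field_hom_on K \<phi>" and z: "z \<in> K"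
  shows "\<phi> (poly (map_poly of_rat p) z) = poly (map_poly of_rat p) (\<phi> z)"
proof (induction p)
  case (pCons c p)
  have "poly (map_poly of_rat q) z \<in> K" for q :: "rat poly"
    using Rats_subset_subfield[OF K]
    by (induction q) (auto simp: map_poly_pCons intro!: subfield_closed[OF K] z)
  moreover have "of_rat c \<in> K" "\<phi> (of_rat c) = of_rat c"
    using Rats_subset_subfield[OF K] hom_Rats[OF K \<phi>] by auto
  ultimately show ?case
    using pCons z by (simp add: map_poly_pCons hom_add[OF K \<phi>] hom_mult[OF K \<phi>] subfield_mult[OF K])
qed (simp add: hom_0[OF K \<phi>])

section \<open>Automorphisms of a splitting field\<close>

context
  fixes p :: "rat poly" and S :: "complex set" and G :: "(complex \<Rightarrow> complex) monoid"
  defines "S \<equiv> carrier (splitting_field p)"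
    and "G \<equiv> galois_group (splitting_field p) \<rat>"
begin

lemma splitting_field_ops:
  "\<one>\<^bsub>splitting_field p\<^esub> = 1" "x \<oplus>\<^bsub>splitting_field p\<^esub> y = x + y"
  "x \<otimes>\<^bsub>splitting_field p\<^esub> y = x * y"
  by (auto simp: splitting_field_def ring_of_type_algebra_def)

lemma galois_group_carrier:
  "\<sigma> \<in> carrier G \<longleftrightarrow> \<sigma> \<in> extensional S \<and> bij_betw \<sigma> S S \<and> field_hom_on S \<sigma>"
proof -
  have S: "is_subfield S"
    by (simp add: S_def is_subfield_splitting_field)
  have "\<sigma> \<in> carrier G \<longleftrightarrow> \<sigma> \<in> extensional S \<and> bij_betw \<sigma> S S \<and> field_hom_on S \<sigma> \<and> (\<forall>x\<in>\<rat>. \<sigma> x = x)"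
    unfolding G_def galois_group_def Bij_def ring_iso_def ring_hom_def field_hom_on_def
    by (auto simp: S_def splitting_field_ops bij_betw_def)
  then show ?thesis
    using hom_Rats[OF S, of \<sigma>] by blast
qed

lemma galois_group_mult:
  assumes "\<sigma> \<in> carrier G" "\<tau> \<in> carrier G"
  shows "\<sigma> \<otimes>\<^bsub>G\<^esub> \<tau> = compose S \<sigma> \<tau>"
  using assms by (auto simp: G_def S_def galois_group_def BijGroup_def)

text \<open>The source of all automorphisms constructed below. The finite set of roots is mapped
  injectively to itself, hence onto; preimage and image of \<open>S\<close> are then subfields
  containing the roots, so \<open>\<phi>\<close> maps \<open>S\<close> onto \<open>S\<close>.
  Restriction makes the map extensional.\<close>

lemma restrict_in_galois_group:
  assumes p: "p \<noteq> 0" and \<phi>: "field_hom_on S \<phi>"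
  shows "restrict \<phi> S \<in> carrier G"
proof -
  have S: "is_subfield S"
    by (simp add: S_def is_subfield_splitting_field)
  have roots: "rat_roots p \<subseteq> S"
    by (simp add: S_def roots_subset_splitting_field)
  have min: "S \<subseteq> K" if "is_subfield K" "rat_roots p \<subseteq> K" for K
    using splitting_field_subset[OF that] by (simp add: S_def)
  have inj: "inj_on \<phi> S"
    by (rule hom_inj_on[OF S \<phi>])
  have sub: "\<phi> ` rat_roots p \<subseteq> rat_roots p"
  proof safe
    fix z :: complex assume z: "poly (map_poly of_rat p) z = 0"
    with roots have "z \<in> S" by blast
    then show "poly (map_poly of_rat p) (\<phi> z) = 0"
      using hom_poly_rat[OF S \<phi>, of z p] z hom_0[OF S \<phi>] by simp
  qed
  have "finite (rat_roots p)"
    using p by (intro poly_roots_finite) (simp add: map_poly_eq_0_iff)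
  then have image: "\<phi> ` rat_roots p = rat_roots p"
    using sub inj_on_subset[OF inj roots] by (simp add: endo_inj_surj)
  have "S \<subseteq> {x \<in> S. \<phi> x \<in> S}"
    using sub roots by (intro min is_subfield_vimage[OF S \<phi> S]) auto
  moreover have "S \<subseteq> \<phi> ` S"
    using image roots by (intro min is_subfield_image[OF S \<phi>]) blast
  ultimately have "\<phi> ` S = S" by blast
  with inj have "bij_betw (restrict \<phi> S) S S"
    by (auto simp: bij_betw_def)
  moreover have "field_hom_on S (restrict \<phi> S)"
    using \<phi> subfield_closed[OF S] by (auto simp: field_hom_on_def)
  ultimately show ?thesis
    by (simp add: galois_group_carrier)
qed

text \<open>The elements on which \<open>\<sigma>\<close> and \<open>\<tau>\<close> agree form a
  subfield containing \<open>A\<close>, hence the roots, hence all of \<open>S\<close>.\<close>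

lemma galois_group_eqI:
  assumes "\<sigma> \<in> carrier G" "\<tau> \<in> carrier G" "A \<subseteq> S" "\<And>x. x \<in> A \<Longrightarrow> \<sigma> x = \<tau> x"
    and gen: "\<And>K. is_subfield K \<Longrightarrow> A \<subseteq> K \<Longrightarrow> rat_roots p \<subseteq> K"
  shows "\<sigma> = \<tau>"
proof -
  have S: "is_subfield S"
    by (simp add: S_def is_subfield_splitting_field)
  have "is_subfield {x \<in> S. \<sigma> x = \<tau> x}"
    using assms by (intro is_subfield_equalizer[OF S]) (auto simp: galois_group_carrier)
  moreover from this have "rat_roots p \<subseteq> {x \<in> S. \<sigma> x = \<tau> x}"
    using assms by (intro gen) auto
  ultimately have "S \<subseteq> {x \<in> S. \<sigma> x = \<tau> x}"
    using splitting_field_subset by (simp add: S_def)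
  then show ?thesis
    using assms by (intro extensionalityI[of \<sigma> S \<tau>]) (auto simp: galois_group_carrier)
qed

lemma galois_group_mult_closed:
  assumes "\<sigma> \<in> carrier G" "\<tau> \<in> carrier G"
  shows "\<sigma> \<otimes>\<^bsub>G\<^esub> \<tau> \<in> carrier G"
proof -
  have S: "is_subfield S"
    by (simp add: S_def is_subfield_splitting_field)
  have "bij_betw (compose S \<sigma> \<tau>) S S"
    using assms by (auto simp: galois_group_carrier intro: bij_betw_compose)
  moreover have "\<tau> x \<in> S" if "x \<in> S" for x
    using assms that by (auto simp: galois_group_carrier dest: bij_betwE)
  then have "field_hom_on S (compose S \<sigma> \<tau>)"
    using assms subfield_1[OF S] subfield_add[OF S] subfield_mult[OF S]
    by (simp add: galois_group_carrier field_hom_on_def compose_def)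
  ultimately show ?thesis
    using assms by (simp add: galois_group_mult galois_group_carrier)
qed

text \<open>Here \<open>R \<sigma> h\<close> reads "\<open>\<sigma>\<close> acts as \<open>h\<close>
  does". The assumptions make \<open>R\<close> the graph of a bijective homomorphism, so an
  isomorphism can be given by describing actions instead of writing down a map.\<close>

lemma galois_group_iso:
  fixes H :: "('h, 'm) monoid_scheme" and R :: "(complex \<Rightarrow> complex) \<Rightarrow> 'h \<Rightarrow> bool"
  assumes ex: "\<And>\<sigma>. \<sigma> \<in> carrier G \<Longrightarrow> \<exists>h\<in>carrier H. R \<sigma> h"
    and uniq: "\<And>\<sigma> h h'. \<sigma> \<in> carrier G \<Longrightarrow> h \<in> carrier H \<Longrightarrow> h' \<in> carrier H \<Longrightarrow>
      R \<sigma> h \<Longrightarrow> R \<sigma> h' \<Longrightarrow> h = h'"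
    and surj: "\<And>h. h \<in> carrier H \<Longrightarrow> \<exists>\<sigma>\<in>carrier G. R \<sigma> h"
    and inj: "\<And>\<sigma> \<tau> h. \<sigma> \<in> carrier G \<Longrightarrow> \<tau> \<in> carrier G \<Longrightarrow> h \<in> carrier H \<Longrightarrow>
      R \<sigma> h \<Longrightarrow> R \<tau> h \<Longrightarrow> \<sigma> = \<tau>"
    and mult: "\<And>\<sigma> \<tau> h k. \<sigma> \<in> carrier G \<Longrightarrow> \<tau> \<in> carrier G \<Longrightarrow> h \<in> carrier H \<Longrightarrow> k \<in> carrier H \<Longrightarrow>
      R \<sigma> h \<Longrightarrow> R \<tau> k \<Longrightarrow> h \<otimes>\<^bsub>H\<^esub> k \<in> carrier H \<and> R (compose S \<sigma> \<tau>) (h \<otimes>\<^bsub>H\<^esub> k)"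
  shows "G \<cong> H"
proof -
  define \<Phi> where "\<Phi> \<sigma> = (SOME h. h \<in> carrier H \<and> R \<sigma> h)" for \<sigma>
  have \<Phi>: "\<Phi> \<sigma> \<in> carrier H \<and> R \<sigma> (\<Phi> \<sigma>)" if "\<sigma> \<in> carrier G" for \<sigma>
    using someI_ex[OF ex[OF that, unfolded Bex_def]] by (simp add: \<Phi>_def)
  have "\<Phi> \<in> iso G H"
    unfolding iso_def hom_def bij_betw_def
  proof (safe, goal_cases)
    case (2 \<sigma> \<tau>)
    then show ?case
      using mult[of \<sigma> \<tau> "\<Phi> \<sigma>" "\<Phi> \<tau>"] \<Phi>[of \<sigma>] \<Phi>[of \<tau>] \<Phi>[of "\<sigma> \<otimes>\<^bsub>G\<^esub> \<tau>"]
        galois_group_mult_closed[of \<sigma> \<tau>] galois_group_mult[of \<sigma> \<tau>]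
        uniq[of "\<sigma> \<otimes>\<^bsub>G\<^esub> \<tau>" "\<Phi> (\<sigma> \<otimes>\<^bsub>G\<^esub> \<tau>)" "\<Phi> \<sigma> \<otimes>\<^bsub>H\<^esub> \<Phi> \<tau>"] by simp
  next
    case 3
    show ?case
    proof (rule inj_onI)
      fix \<sigma> \<tau> assume "\<sigma> \<in> carrier G" "\<tau> \<in> carrier G" "\<Phi> \<sigma> = \<Phi> \<tau>"
      then show "\<sigma> = \<tau>"
        using inj[of \<sigma> \<tau> "\<Phi> \<sigma>"] \<Phi>[of \<sigma>] \<Phi>[of \<tau>] by simp
    qed
  next
    case (5 h)
    then obtain \<sigma> where "\<sigma> \<in> carrier G" "R \<sigma> h"
      using surj by blast
    then have "\<Phi> \<sigma> = h"
      using uniq[of \<sigma> "\<Phi> \<sigma>" h] \<Phi>[of \<sigma>] 5 by blast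
    then show ?case
      using \<open>\<sigma> \<in> carrier G\<close> by blast
  qed (use \<Phi> in auto)
  then show ?thesis
    by (auto simp: is_iso_def)
qed

end

subsection \<open>Cube roots of unity and the roots of depressed cubics\<close>

definition sqrt_m3 :: complex
  where "sqrt_m3 = \<i> * complex_of_real (sqrt 3)"

definition omega :: complex
  where "omega = (sqrt_m3 - 1) / 2"

lemma sqrt_m3_squared: "sqrt_m3 ^ 2 = - 3"
  by (simp add: sqrt_m3_def power_mult_distrib flip: of_real_power)

lemma sqrt_m3_eq: "sqrt_m3 = 2 * omega + 1"
  by (simp add: omega_def)

lemma omega_squared: "omega ^ 2 = - 1 - omega"
  using sqrt_m3_squared by (simp add: omega_def power2_eq_square field_simps)

lemma omega_cubed: "omega ^ 3 = 1"
proof -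
  have "omega ^ 3 = omega * omega ^ 2"
    by (simp add: power2_eq_square power3_eq_cube)
  also have "\<dots> = - omega - omega ^ 2"
    unfolding omega_squared by (simp add: algebra_simps power2_eq_square [symmetric] omega_squared)
  also have "\<dots> = 1"
    by (simp add: omega_squared)
  finally show ?thesis .
qed

lemma omega_nonzero: "omega \<noteq> 0"
  using omega_cubed by auto

lemma omega_neq_1: "omega \<noteq> 1"
  using omega_squared by auto

lemma omega_powi_mod: "omega powi (j mod 3) = omega powi j"
proof -
  have "omega powi j = omega powi (3 * (j div 3) + j mod 3)"
    by simp
  also have "\<dots> = (omega powi 3) powi (j div 3) * omega powi (j mod 3)"
    using omega_nonzero by (subst power_int_add) (simp_all only: power_int_mult simp_thms)
  finally show ?thesis
    by (simp add: omega_cubed)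
qed

lemma omega_powi_cong: "[i = j] (mod 3) \<Longrightarrow> omega powi i = omega powi j"
  by (metis omega_powi_mod cong_def)

lemma omega_powi_cubed: "(omega powi j) ^ 3 = 1"
  by (metis omega_cubed power_int_1_left power_int_mult power_int_power power_int_power' mult.commute)

lemma omega_powi_eq_iff: "omega powi i = omega powi j \<longleftrightarrow> [i = j] (mod 3)"
proof
  assume "omega powi i = omega powi j"
  then have "omega powi (i - j) = 1"
    using omega_nonzero by (simp add: power_int_diff)
  then have *: "omega powi ((i - j) mod 3) = 1"
    by (simp add: omega_powi_mod)
  have "(i - j) mod 3 = 0 \<or> (i - j) mod 3 = 1 \<or> (i - j) mod 3 = 2"
    by presburger
  moreover have "omega ^ 2 \<noteq> 1"
    using omega_cubed omega_neq_1 by (auto simp: numeral_3_eq_3 numeral_2_eq_2)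
  ultimately have "(i - j) mod 3 = 0"
    using * omega_neq_1 by auto
  then show "[i = j] (mod 3)"
    by (simp add: cong_def mod_eq_dvd_iff dvd_eq_mod_eq_0)
qed (rule omega_powi_cong)

text \<open>Cardano's formula: for \<open>j\<close> modulo 3 these are the roots of
  \<open>z ^ 3 - 3 * (x * y) * z - (x ^ 3 + y ^ 3)\<close>. Integer indices allow shifts and sign
  changes, and \<open>y = 0\<close> gives the three cube roots of \<open>x ^ 3\<close>.\<close>

definition cardano :: "complex \<Rightarrow> complex \<Rightarrow> int \<Rightarrow> complex"
  where "cardano x y j = omega powi j * x + omega powi (- j) * y"

lemma cardano_cong: "[i = j] (mod 3) \<Longrightarrow> cardano x y i = cardano x y j"
  unfolding cardano_def
  using omega_powi_cong[of i j] omega_powi_cong[of "- i" "- j"] by (simp add: cong_minus_minus_iff)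

lemma cardano_shift: "cardano (omega powi k * x) (omega powi (- k) * y) j = cardano x y (j + k)"
proof -
  have "omega powi (j + k) = omega powi j * omega powi k"
      "omega powi (- j + - k) = omega powi (- j) * omega powi (- k)"
    by (intro power_int_add disjI1 omega_nonzero)+
  then show ?thesis
    by (simp add: cardano_def)
qed

lemma cardano_swap: "cardano y x j = cardano x y (- j)"
  by (simp add: cardano_def)

text \<open>For distinct cube roots of unity \<open>v\<close>, \<open>w\<close>, an equality
  \<open>v * x + y / v = w * x + y / w\<close> forces \<open>y = v * w * x\<close> and therefore
  equal cubes.\<close>

lemma cardano_eq_iff:
  assumes "x ^ 3 \<noteq> y ^ 3"
  shows "cardano x y i = cardano x y j \<longleftrightarrow> [i = j] (mod 3)"
proof
  assume eq: "cardano x y i = cardano x y j"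
  show "[i = j] (mod 3)"
  proof (rule ccontr)
    assume "\<not> [i = j] (mod 3)"
    then have ne: "omega powi i \<noteq> omega powi j"
      by (simp add: omega_powi_eq_iff)
    define v w where "v = omega powi i" and "w = omega powi j"
    have vw: "v \<noteq> 0" "w \<noteq> 0" "v \<noteq> w" "v ^ 3 = 1" "w ^ 3 = 1"
      using ne omega_nonzero by (simp_all add: v_def w_def omega_powi_cubed)
    have "v * x + y / v = w * x + y / w"
      using eq by (simp add: cardano_def power_int_minus divide_inverse mult.commute flip: v_def w_def)
    moreover have "(v * x + y / v) * (v * w) = v ^ 2 * w * x + w * y"
        "(w * x + y / w) * (v * w) = v * w ^ 2 * x + v * y"
      using vw by (simp_all add: distrib_right power2_eq_square)
    ultimately have "v ^ 2 * w * x + w * y = v * w ^ 2 * x + v * y"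
      by simp
    then have "(v - w) * (v * w * x - y) = 0"
      by (simp add: algebra_simps power2_eq_square)
    then have "y = v * w * x"
      using vw by simp
    then have "y ^ 3 = x ^ 3"
      using vw by (simp add: power_mult_distrib)
    with assms show False by simp
  qed
qed (rule cardano_cong)

text \<open>Index 3 takes the place of 0, because \<open>sym_group 3\<close> permutes
  \<open>{1..3}\<close>.\<close>

lemma cardano_values:
  "cardano x y 1 = omega * x + omega ^ 2 * y" "cardano x y 2 = omega ^ 2 * x + omega * y"
  "cardano x y 3 = x + y"
proof -
  have "omega powi - 1 = omega powi 2" "omega powi - 2 = omega powi 1" "omega powi 3 = omega powi 0"
      "omega powi - 3 = omega powi 0"
    by (intro omega_powi_cong; simp add: cong_def)+
  then show "cardano x y 1 = omega * x + omega ^ 2 * y" "cardano x y 2 = omega ^ 2 * x + omega * y"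
      "cardano x y 3 = x + y"
    unfolding cardano_def by simp_all
qed

lemma cardano_product:
  "(z - cardano x y 1) * (z - cardano x y 2) * (z - cardano x y 3) =
    z ^ 3 - 3 * (x * y) * z - (x ^ 3 + y ^ 3)"
proof -
  have "omega ^ 2 + omega + 1 = 0"
    by (simp add: omega_squared)
  then show ?thesis
    unfolding cardano_values by Groebner_Basis.algebra
qed

lemma cardano_root: 
  assumes "z ^ 3 - 3 * (x * y) * z - (x ^ 3 + y ^ 3) = 0"
  shows "\<exists>j\<in>{1..3::nat}. z = cardano x y (int j)"
proof -
  from assms have "z = cardano x y (int 1) \<or> z = cardano x y (int 2) \<or> z = cardano x y (int 3)"
    unfolding cardano_product [symmetric] by auto
  then show ?thesis
    by (metis atLeastAtMost_iff numeral_le_iff one_le_numeral order_refl semiring_norm(69,71,72))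
qed

lemma cardano_cubic:
  "cardano x y j ^ 3 - 3 * (x * y) * cardano x y j - (x ^ 3 + y ^ 3) = 0"
proof -
  define u where "u = omega powi j"
  have u: "u \<noteq> 0" "u ^ 3 = 1"
    using omega_nonzero by (simp_all add: u_def omega_powi_cubed)
  define v where "v = inverse u"
  have uv: "u * v = 1" "v ^ 3 = 1" "u ^ 3 = 1"
    using u by (simp_all add: v_def power_inverse)
  have "cardano x y j = u * x + v * y"
    by (simp add: cardano_def u_def v_def power_int_minus)
  then show ?thesis
    using uv by Groebner_Basis.algebra
qed

text \<open>The affine group of the integers modulo 3 has six elements and is therefore the full
  symmetric group; the six permutations are listed.\<close>

lemma permutes_affine_mod_3:
  assumes "p permutes {1..3::nat}"
  shows "\<exists>d k. d \<in> {1, -1} \<and> (\<forall>j\<in>{1..3}. [int (p j) = d * int j + k] (mod 3))"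
proof -
  have set: "{1..3::nat} = {1, 2, 3}"
    by auto
  define a b c where "a = int (p 1)" and "b = int (p 2)" and "c = int (p 3)"
  have "p 1 \<in> {1..3}" "p 2 \<in> {1..3}" "p 3 \<in> {1..3}"
    using permutes_in_image[OF assms] by auto
  then have range: "1 \<le> a" "a \<le> 3" "1 \<le> b" "b \<le> 3" "1 \<le> c" "c \<le> 3"
    by (auto simp: a_def b_def c_def)
  have ne: "a \<noteq> b" "a \<noteq> c" "b \<noteq> c"
    unfolding a_def b_def c_def of_nat_eq_iff inj_eq[OF permutes_inj[OF assms]] by simp_all
  have I: ?thesis if "d \<in> {1, -1}" "[a = d + k] (mod 3)" "[b = d * 2 + k] (mod 3)" "[c = d * 3 + k] (mod 3)"
    for d k
    using that unfolding set a_def b_def c_def by (intro exI[of _ d] exI[of _ k]) auto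
  have "a = 1 \<or> a = 2 \<or> a = 3" "b = 1 \<or> b = 2 \<or> b = 3" "c = 1 \<or> c = 2 \<or> c = 3"
    using range by presburger+
  then consider "a = 1" "b = 2" "c = 3" | "a = 2" "b = 3" "c = 1" | "a = 3" "b = 1" "c = 2"
    | "a = 1" "b = 3" "c = 2" | "a = 3" "b = 2" "c = 1" | "a = 2" "b = 1" "c = 3"
    using ne by metis
  then show ?thesis
  proof cases
    case 1 show ?thesis by (rule I[of 1 0]) (simp_all add: 1)
  next
    case 2 show ?thesis by (rule I[of 1 1]) (simp_all add: 2 cong_def)
  next
    case 3 show ?thesis by (rule I[of 1 2]) (simp_all add: 3 cong_def)
  next
    case 4 show ?thesis by (rule I[of "-1" 2]) (simp_all add: 4 cong_def)
  next
    case 5 show ?thesis by (rule I[of "-1" 1]) (simp_all add: 5 cong_def)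
  next
    case 6 show ?thesis by (rule I[of "-1" 0]) (simp_all add: 6 cong_def)
  qed
qed

text \<open>A sign change of \<open>sqrt_m3\<close> exchanges \<open>omega\<close> with its inverse,
  so \<open>omega\<close> is sent to \<open>omega powi d\<close>.\<close>

lemma hom_cardano:
  assumes K: "is_subfield K" and \<phi>: "field_hom_on K \<phi>" and in_K: "sqrt_m3 \<in> K" "x \<in> K" "y \<in> K"
    and d: "d \<in> {1, -1}" "\<phi> sqrt_m3 = of_int d * sqrt_m3"
  shows "\<phi> (cardano x y j) = cardano (\<phi> x) (\<phi> y) (d * j)"
proof -
  have omega: "omega \<in> K"
    unfolding omega_def by (intro subfield_closed[OF K] in_K)
  have "\<phi> omega = omega powi d"
  proof -
    have "\<phi> omega = (of_int d * sqrt_m3 - 1) / 2"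
      unfolding omega_def using in_K by (simp add: hom_simps[OF K \<phi>] subfield_closed[OF K] d(2))
    also have "\<dots> = omega powi d"
    proof (cases "d = 1")
      case False
      with d have d': "d = -1" by simp
      have "omega powi d = omega powi 2"
        unfolding d' by (rule omega_powi_cong) (simp add: cong_def)
      also have "\<dots> = - 1 - omega"
        by (simp add: omega_squared)
      finally have "omega powi d = - 1 - omega" .
      moreover have "(of_int d * sqrt_m3 - 1) / 2 = - 1 - omega"
        by (simp add: d' omega_def field_simps)
      ultimately show ?thesis by simp
    qed (simp add: omega_def)
    finally show ?thesis .
  qed
  then have "\<phi> (omega powi i) = omega powi (d * i)" for i
    using omega by (simp add: hom_power_int[OF K \<phi>] power_int_mult)
  then show ?thesis
    unfolding cardano_def using omega in_K
    by (simp add: hom_add[OF K \<phi>] hom_mult[OF K \<phi>] subfield_mult[OF K] subfield_power_int[OF K])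
qed

text \<open>The cubic has rational coefficients, so \<open>\<phi>\<close> maps its roots to its
  roots; injectivity of \<open>\<phi>\<close> and distinctness of the roots turn this into a
  permutation of indices.\<close>

lemma hom_permutes_cardano:
  assumes K: "is_subfield K" and \<phi>: "field_hom_on K \<phi>" and in_K: "\<And>j. cardano x y j \<in> K"
    and rat: "x * y \<in> \<rat>" "x ^ 3 + y ^ 3 \<in> \<rat>" and ne: "x ^ 3 \<noteq> y ^ 3"
  shows "\<exists>p. p permutes {1..3::nat} \<and> (\<forall>j\<in>{1..3}. \<phi> (cardano x y (int j)) = cardano x y (int (p j)))"
proof -
  have "\<exists>i\<in>{1..3::nat}. \<phi> (cardano x y (int j)) = cardano x y (int i)" for j
  proof (rule cardano_root)
    define c where "c = cardano x y (int j)"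
    have c: "c \<in> K"
      by (simp add: c_def in_K)
    have xy: "x * y \<in> K" "x ^ 3 + y ^ 3 \<in> K" "\<phi> (x * y) = x * y" "\<phi> (x ^ 3 + y ^ 3) = x ^ 3 + y ^ 3"
      using rat Rats_subset_subfield[OF K] hom_Rats[OF K \<phi>] by blast+
    have mem: "c ^ 3 \<in> K" "3 * (x * y) * c \<in> K" "c ^ 3 - 3 * (x * y) * c \<in> K" "3 * (x * y) \<in> K"
        "(3 :: complex) \<in> K"
      by (intro subfield_closed[OF K] c xy(1))+
    have "\<phi> (c ^ 3 - 3 * (x * y) * c - (x ^ 3 + y ^ 3)) = 
        \<phi> c ^ 3 - 3 * (x * y) * \<phi> c - (x ^ 3 + y ^ 3)"
      by (simp only: hom_diff[OF K \<phi>] hom_mult[OF K \<phi>] hom_power[OF K \<phi>] hom_numeral[OF K \<phi>] mem c xy)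
    then show "\<phi> (cardano x y (int j)) ^ 3 - 3 * (x * y) * \<phi> (cardano x y (int j)) - (x ^ 3 + y ^ 3) = 0"
      using cardano_cubic[of x y "int j"] hom_0[OF K \<phi>] by (simp add: c_def)
  qed
  then obtain q where q: "\<And>j. q j \<in> {1..3::nat}"
      "\<And>j. \<phi> (cardano x y (int j)) = cardano x y (int (q j))"
    by metis
  have "inj_on q {1..3}"
  proof (rule inj_onI)
    fix i j :: nat
    assume ij: "i \<in> {1..3}" "j \<in> {1..3}" "q i = q j"
    then have "\<phi> (cardano x y (int i)) = \<phi> (cardano x y (int j))"
      by (simp add: q)
    then have "cardano x y (int i) = cardano x y (int j)"
      by (rule inj_onD[OF hom_inj_on[OF K \<phi>]]) (rule in_K)+
    then have "[int i = int j] (mod 3)"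
      by (simp add: cardano_eq_iff[OF ne])
    then obtain m where "int i - int j = 3 * m"
      by (auto simp: cong_iff_dvd_diff elim: dvdE)
    with ij show "i = j"
      by simp presburger
  qed
  \<comment> \<open>Extended by the identity, as \<open>permutes\<close> demands outside
    \<open>{1..3}\<close>.\<close>
  then have "(\<lambda>j. if j \<in> {1..3} then q j else j) permutes {1..3}"
    using q(1) by (intro inj_imp_permutes) (auto simp: inj_on_def)
  then show ?thesis
    using q by (intro exI[of _ "\<lambda>j. if j \<in> {1..3} then q j else j"]) auto
qed

lemma hom_affine_cardano:
  assumes "is_subfield K" "field_hom_on K \<phi>" "\<And>j. cardano x y j \<in> K"
    and "x * y \<in> \<rat>" "x ^ 3 + y ^ 3 \<in> \<rat>" "x ^ 3 \<noteq> y ^ 3"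
  shows "\<exists>d k. d \<in> {1, -1} \<and> (\<forall>j. \<phi> (cardano x y j) = cardano x y (d * j + k))"
proof -
  obtain p where p: "p permutes {1..3::nat}"
      "\<And>j. j \<in> {1..3} \<Longrightarrow> \<phi> (cardano x y (int j)) = cardano x y (int (p j))"
    using hom_permutes_cardano[OF assms] by blast
  obtain d k where dk: "d \<in> {1, -1}" "\<And>j. j \<in> {1..3} \<Longrightarrow> [int (p j) = d * int j + k] (mod 3)"
    using permutes_affine_mod_3[OF p(1)] by blast
  have "\<phi> (cardano x y j) = cardano x y (d * j + k)" for j
  proof -
    \<comment> \<open>The representative of \<open>j\<close> modulo 3 in \<open>{1..3}\<close>; the
      shift by 1 makes multiples of 3 give 3 rather than 0.\<close>
    define i where "i = nat ((j - 1) mod 3) + 1"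
    have i: "i \<in> {1..3}"
      by (auto simp: i_def nat_le_iff)
    have "int i = (j - 1) mod 3 + 1"
      by (simp add: i_def)
    then have ij: "[int i = j] (mod 3)"
      by (simp add: cong_def mod_simps)
    have "\<phi> (cardano x y j) = \<phi> (cardano x y (int i))"
      using cardano_cong[OF ij] by simp
    also have "\<dots> = cardano x y (d * int i + k)"
      using p(2)[OF i] cardano_cong[OF dk(2)[OF i]] by simp
    also have "\<dots> = cardano x y (d * j + k)"
      by (intro cardano_cong cong_add cong_mult ij cong_refl)
    finally show ?thesis .
  qed
  with dk(1) show ?thesis by blast
qed

text \<open>Two effects each reverse the index: inverting \<open>omega\<close>, recorded by
  \<open>d\<close>, and exchanging \<open>x\<close> and \<open>y\<close>, recorded by
  \<open>e\<close>. Hence the slope \<open>e * d\<close>, while the factors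
  \<open>omega powi k\<close> and \<open>omega powi (- k)\<close> contribute the shift.\<close>

lemma hom_twist_cardano:
  assumes K: "is_subfield K" and \<phi>: "field_hom_on K \<phi>" and in_K: "sqrt_m3 \<in> K" "x \<in> K" "y \<in> K"
    and d: "d \<in> {1, -1}" "\<phi> sqrt_m3 = of_int d * sqrt_m3" and e: "e \<in> {1, -1}"
    and x: "\<phi> x = (if e = 1 then omega powi k * x else omega powi (- k) * y)"
    and y: "\<phi> y = (if e = 1 then omega powi (- k) * y else omega powi k * x)"
  shows "\<phi> (cardano x y j) = cardano x y (e * d * j + k)"
proof (cases "e = 1")
  case True
  then show ?thesis
    using hom_cardano[OF K \<phi> in_K d] x y by (simp add: cardano_shift)
next
  case False
  then have e': "e = -1"
    using e by simp
  have "\<phi> (cardano x y j) = cardano (omega powi (- k) * y) (omega powi (- (- k)) * x) (d * j)"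
    using hom_cardano[OF K \<phi> in_K d] x y by (simp add: e')
  also have "\<dots> = cardano y x (d * j + - k)"
    by (rule cardano_shift)
  also have "\<dots> = cardano x y (e * d * j + k)"
    unfolding cardano_swap[of y x] by (simp add: e')
  finally show ?thesis .
qed

text \<open>Two of the roots are linear equations for \<open>x\<close> and \<open>y\<close>;
  eliminating \<open>y\<close> leaves the coefficient \<open>omega - omega ^ 2\<close>, which is
  \<open>sqrt_m3\<close>.\<close>

lemma cardano_generators:
  assumes M: "is_subfield M" and "sqrt_m3 \<in> M" "cardano x y 1 \<in> M" "cardano x y 3 \<in> M"
  shows "x \<in> M" "y \<in> M"
proof -
  have omega: "omega \<in> M"
    unfolding omega_def by (intro subfield_closed[OF M] assms)
  have nz: "sqrt_m3 \<noteq> 0"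
    using sqrt_m3_squared by auto
  have "cardano x y 1 - omega ^ 2 * cardano x y 3 = sqrt_m3 * x"
    unfolding cardano_values by (simp add: omega_squared sqrt_m3_eq algebra_simps)
  then have "x = (cardano x y 1 - omega ^ 2 * cardano x y 3) / sqrt_m3"
    using nz by simp
  also have "\<dots> \<in> M"
    by (intro subfield_diff[OF M] subfield_divide[OF M] subfield_mult[OF M] subfield_power[OF M] omega assms)
  finally show x: "x \<in> M" .
  have "y = cardano x y 3 - x"
    by (simp add: cardano_values)
  also have "\<dots> \<in> M"
    by (intro subfield_diff[OF M] x assms)
  finally show "y \<in> M" .
qed

lemma cardano_0_right: "cardano x 0 j = omega powi j * x"
  by (simp add: cardano_def)

lemma cube_roots_in_subfield:
  assumes M: "is_subfield M" "sqrt_m3 \<in> M" "x \<in> M" and "z ^ 3 = x ^ 3"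
  shows "z \<in> M"
proof -
  have omega: "omega \<in> M"
    unfolding omega_def by (intro subfield_closed[OF M(1)] M(2))
  obtain j :: nat where "z = cardano x 0 (int j)"
    using cardano_root[of z x 0] assms by auto
  then show ?thesis
    unfolding cardano_0_right by (simp del: power_int_of_nat) (intro subfield_closed[OF M(1)] M omega)
qed

subsection \<open>Irreducible rational polynomials\<close>

text \<open>A nonzero rational polynomial of least degree vanishing at \<open>z\<close> divides
  \<open>f\<close> by division with remainder, so it is associated to the irreducible
  \<open>f\<close>. This is how irreducibility keeps roots of \<open>f\<close> out of small
  extensions.\<close>

lemma irreducible_degree_le:
  fixes f g :: "rat poly" and z :: complex
  assumes f: "Factorial_Ring.irreducible f" "poly (map_poly of_rat f) z = 0"
    and g: "g \<noteq> 0" "poly (map_poly of_rat g) z = 0"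
  shows "degree f \<le> degree g"
proof -
  define P where "P n \<longleftrightarrow> (\<exists>m::rat poly. m \<noteq> 0 \<and> poly (map_poly of_rat m) z = 0 \<and> degree m = n)" for n
  have Pg: "P (degree g)"
    using g by (auto simp: P_def)
  then have "P (LEAST n. P n)"
    by (rule LeastI)
  then obtain m where m: "m \<noteq> 0" "poly (map_poly of_rat m) z = 0" "degree m = (LEAST n. P n)"
    by (auto simp: P_def)
  have "(LEAST n. P n) \<le> degree g"
    using Pg by (rule Least_le)
  have add: "map_poly of_rat (p + q) = (map_poly of_rat p + map_poly of_rat q :: complex poly)" for p q
    by (intro poly_eqI) (simp add: coeff_map_poly of_rat_add)
  have mult: "map_poly of_rat (p * q) = (map_poly of_rat p * map_poly of_rat q :: complex poly)" for p q
    by (intro poly_eqI) (simp add: coeff_map_poly coeff_mult of_rat_sum of_rat_mult)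
  have "0 = poly (map_poly of_rat (f div m * m + f mod m)) z"
    using f(2) by simp
  also have "\<dots> = poly (map_poly of_rat (f mod m)) z"
    unfolding add mult by (simp add: m(2))
  finally have "poly (map_poly of_rat (f mod m)) z = 0"
    by simp
  have "f mod m = 0"
  proof (rule ccontr)
    assume ne: "f mod m \<noteq> 0"
    then have "P (degree (f mod m))"
      using \<open>poly (map_poly of_rat (f mod m)) z = 0\<close> by (auto simp: P_def)
    then have "degree m \<le> degree (f mod m)"
      unfolding m(3) by (rule Least_le)
    with degree_mod_less[OF m(1), of f] ne show False by simp
  qed
  then obtain c where c: "f = m * c"
    by (auto simp: mod_eq_0_iff_dvd elim: dvdE)
  have "\<not> m dvd 1"
  proof
    assume "m dvd 1"
    then obtain a where "m = [:a:]" "a \<noteq> 0"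
      using m(1) by (auto elim!: is_unit_polyE)
    with m(2) show False
      by (simp add: map_poly_pCons)
  qed
  then have "c dvd 1"
    using Factorial_Ring.irreducibleD[OF f(1) c] by blast
  then have "degree c = 0" "c \<noteq> 0"
    by (auto elim!: is_unit_polyE)
  then have "degree f = degree m"
    using m(1) c by (simp add: degree_mult_eq)
  with \<open>(LEAST n. P n) \<le> degree g\<close> m(3) show ?thesis
    by simp
qed

lemma rational_cubic_root_is_int:
  fixes q :: rat
  assumes "q ^ 3 + of_int m * q + of_int n = 0"
  shows "\<exists>k. q = of_int k"
proof -
  have "algebraic_int q"
    using assms
    by (intro algebraic_int.intros[of "[:of_int n, of_int m, 0, 1:]"])
      (auto simp: coeff_pCons split: nat.splits, simp add: algebra_simps power3_eq_cube)
  then have "q \<in> \<int>"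
    by (rule rational_algebraic_int_is_int) (metis Rats_of_rat of_rat_eq_id id_apply)
  then show ?thesis
    by (auto elim: Ints_cases)
qed

lemma field_hom_on_subset: "field_hom_on K \<phi> \<Longrightarrow> L \<subseteq> K \<Longrightarrow> field_hom_on L \<phi>"
  unfolding field_hom_on_def by blast

text \<open>The cofactor \<open>x ^ 2 + x * y + y ^ 2\<close> is positive definite: four times it is
  \<open>(2 * x + y) ^ 2 + 3 * y ^ 2\<close>.\<close>

lemma rat_cube_inj:
  fixes x y :: rat
  assumes "x ^ 3 = y ^ 3"
  shows "x = y"
proof -
  have "(x - y) * (x ^ 2 + x * y + y ^ 2) = 0"
    using assms by (simp add: algebra_simps power2_eq_square power3_eq_cube)
  then consider "x = y" | "x ^ 2 + x * y + y ^ 2 = 0"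
    by auto
  then show ?thesis
  proof cases
    case 2
    then have "(2 * x + y) ^ 2 + 3 * y ^ 2 = 0"
      by (simp add: algebra_simps power2_eq_square)
    then have "y = 0" "2 * x + y = 0"
      by (simp_all add: add_nonneg_eq_0_iff)
    then show ?thesis by simp
  qed
qed

section \<open>Residues modulo 6 as pairs of residues modulo 3 and 2\<close>

lemma cong_6_iff:
  fixes k l :: int
  shows "[k = l] (mod 6) \<longleftrightarrow> [k = l] (mod 3) \<and> (even k \<longleftrightarrow> even l)"
proof -
  have "6 dvd x \<longleftrightarrow> 3 dvd x \<and> even x" for x :: int
    by presburger
  from this[of "k - l"] show ?thesis
    by (simp add: cong_iff_dvd_diff)
qed

lemma mod_6_choice:
  fixes k p :: int
  obtains m where "0 \<le> m" "m < 6" "[k = m] (mod 3)" "even m \<longleftrightarrow> even p"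
proof
  \<comment> \<open>Chinese remainders: 4 is 1 modulo 3 and 0 modulo 2, while 3 is 0 modulo 3 and 1
    modulo 2.\<close>
  define m where "m = (4 * k + 3 * p) mod 6"
  show "0 \<le> m" "m < 6" "even m \<longleftrightarrow> even p"
    by (auto simp: m_def dvd_mod_iff)
  have "k - (4 * k + 3 * p) = 3 * (- k - p)"
    by simp
  then have "[k = 4 * k + 3 * p] (mod 3)"
    unfolding cong_iff_dvd_diff by (metis dvd_triv_left)
  then show "[k = m] (mod 3)"
    by (simp add: m_def cong_def mod_mod_cancel)
qed

lemma sign_cong_3:
  fixes d e :: int
  assumes "d \<in> {1, -1}" "e \<in> {1, -1}" "[d = e] (mod 3)"
  shows "d = e"
  using assms by (auto simp: cong_def)

subsection \<open>The splitting field of the sextic\<close>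

text \<open>\<open>not_sq\<close> keeps \<open>sqrt_m3\<close> out of the field generated by
  \<open>r\<close>. Of \<open>\<alpha>\<close> and \<open>\<beta>\<close> only the cubes are
  prescribed, so each case of the theorem can choose a suitable \<open>\<beta>\<close>.\<close>

locale sextic =
  fixes a b :: int and f :: "rat poly" and r \<alpha> \<beta> :: complex
  assumes f: "f = monom 1 6 + monom (of_int a) 3 + [:of_int b:]"
    and irred: "Factorial_Ring.irreducible f"
    and not_sq: "\<And>n::rat. of_int (a ^ 2 - 4 * b) \<noteq> - 3 * n ^ 2"
    and r: "r ^ 2 = of_int (a ^ 2 - 4 * b)"
    and \<alpha>: "\<alpha> ^ 3 = (- of_int a + r) / 2"
    and \<beta>: "\<beta> ^ 3 = (- of_int a - r) / 2"
begin

abbreviation "\<Delta> \<equiv> a ^ 2 - 4 * b"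
abbreviation "S \<equiv> carrier (splitting_field f)"
abbreviation "G \<equiv> galois_group (splitting_field f) \<rat>"

definition L :: "complex set"
  where "L = adjoin_sqrt \<rat> r"

definition K :: "complex set"
  where "K = adjoin_sqrt L sqrt_m3"

lemma cubes_mult: "\<alpha> ^ 3 * \<beta> ^ 3 = of_int b"
proof -
  have "\<alpha> ^ 3 * \<beta> ^ 3 = (of_int a ^ 2 - r ^ 2) / 4"
    unfolding \<alpha> \<beta> by (simp add: algebra_simps power2_eq_square)
  then show ?thesis
    unfolding r by simp
qed

lemma cubes_add: "\<alpha> ^ 3 + \<beta> ^ 3 = - of_int a"
  and cubes_diff: "\<alpha> ^ 3 - \<beta> ^ 3 = r"
  unfolding \<alpha> \<beta> by (simp_all add: field_simps)

lemma f_nonzero: "f \<noteq> 0"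
  using irred by auto

lemma poly_f: "poly (map_poly of_rat f) (z::complex) = z ^ 6 + of_int a * z ^ 3 + of_int b"
proof -
  have "map_poly of_rat f = (monom 1 6 + monom (of_int a) 3 + [:of_int b:] :: complex poly)"
    unfolding f by (intro poly_eqI) (auto simp: coeff_map_poly coeff_pCons of_rat_add split: nat.splits)
  then show ?thesis
    by (simp add: poly_monom)
qed

lemma degree_f: "degree f = 6"
proof (rule antisym)
  show "degree f \<le> 6"
    unfolding f by (intro degree_add_le degree_monom_le[THEN order_trans]) auto
  show "6 \<le> degree f"
    by (rule le_degree) (simp add: f coeff_pCons split: nat.splits)
qed

lemma poly_f_eq_0_iff: "poly (map_poly of_rat f) z = 0 \<longleftrightarrow> z ^ 3 = \<alpha> ^ 3 \<or> z ^ 3 = \<beta> ^ 3"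
proof -
  have "poly (map_poly of_rat f) z = (z ^ 3) ^ 2 - (\<alpha> ^ 3 + \<beta> ^ 3) * z ^ 3 + \<alpha> ^ 3 * \<beta> ^ 3"
    unfolding poly_f cubes_add cubes_mult by (simp flip: power_mult)
  also have "\<dots> = (z ^ 3 - \<alpha> ^ 3) * (z ^ 3 - \<beta> ^ 3)"
    by (simp add: algebra_simps power2_eq_square)
  finally show ?thesis by auto
qed

text \<open>Otherwise \<open>\<alpha>\<close> would be a root of a rational cubic, against the
  degree 6 of \<open>f\<close>.\<close>

lemma r_notin_Rats: "r \<notin> \<rat>"
proof
  assume "r \<in> \<rat>"
  then obtain q where q: "r = of_rat q"
    by (auto elim: Rats_cases)
  define g :: "rat poly" where "g = [:(of_int a - q) / 2, 0, 0, 1:]"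
  have "poly (map_poly of_rat g) \<alpha> = \<alpha> ^ 3 + (of_int a - r) / 2"
    by (simp add: g_def q map_poly_pCons of_rat_divide of_rat_diff power3_eq_cube)
  also have "\<dots> = 0"
    unfolding \<alpha> by (simp add: field_simps)
  finally have "degree f \<le> degree g"
    using irred by (intro irreducible_degree_le[where z = \<alpha>]) (auto simp: poly_f_eq_0_iff g_def)
  then show False
    by (simp add: degree_f g_def)
qed

lemma r_squared_Rats: "r ^ 2 \<in> \<rat>"
  unfolding r by simp

lemmas unique_L = adjoin_sqrt_unique[OF is_subfield_Rats r_notin_Rats r_squared_Rats]

lemma L: "is_subfield L"
  unfolding L_def by (rule is_subfield_adjoin_sqrt[OF is_subfield_Rats r_notin_Rats r_squared_Rats])

lemma Rats_subset_L: "\<rat> \<subseteq> L"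
  by (rule Rats_subset_subfield[OF L])

lemma r_in_L: "r \<in> L"
  unfolding L_def by (rule in_adjoin_sqrt[OF is_subfield_Rats r_notin_Rats r_squared_Rats])

text \<open>Squaring \<open>p + q * r\<close> gives \<open>p * q = 0\<close>. With
  \<open>q = 0\<close>, -3 would be a rational square; with \<open>p = 0\<close>,
  \<open>\<Delta>\<close> would have the form excluded by \<open>not_sq\<close>.\<close>

lemma sqrt_m3_notin_L: "sqrt_m3 \<notin> L"
proof
  assume "sqrt_m3 \<in> L"
  then obtain p q where pq: "p \<in> \<rat>" "q \<in> \<rat>" "sqrt_m3 = p + q * r"
    by (auto simp: L_def adjoin_sqrt_def)
  then obtain p' q' where rat: "p = of_rat p'" "q = of_rat q'"
    by (auto elim!: Rats_cases)
  have "-3 + 0 * r = p ^ 2 + q ^ 2 * r ^ 2 + (2 * p * q) * r"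
    using sqrt_m3_squared unfolding pq(3) by (simp add: algebra_simps power2_eq_square)
  note eqs = unique_L[OF _ _ _ _ this]
  have *: "-3 = p ^ 2 + q ^ 2 * r ^ 2" "0 = 2 * p * q"
    by (rule eqs; use pq r_squared_Rats in simp)+
  have "(of_rat (- 3) :: complex) = of_rat (p' ^ 2 + q' ^ 2 * of_int \<Delta>)"
    using *(1) unfolding rat r
    by (simp add: of_rat_power of_rat_mult of_rat_add of_rat_diff of_rat_minus)
  then have "-3 = p' ^ 2 + q' ^ 2 * of_int \<Delta>"
    by (simp only: of_rat_eq_iff)
  moreover have "p' = 0 \<or> q' = 0"
    using *(2) by (simp add: rat)
  ultimately consider "-3 = p' ^ 2" | "q' \<noteq> 0" "-3 = q' ^ 2 * of_int \<Delta>"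
    by force
  then show False
  proof cases
    case 1
    then show False
      using zero_le_power2[of p'] by linarith
  next
    case 2
    then have "of_int \<Delta> = - 3 * (1 / q') ^ 2"
      by (simp add: field_simps)
    with not_sq show False by blast
  qed
qed

lemma sqrt_m3_squared_in: "is_subfield M \<Longrightarrow> sqrt_m3 ^ 2 \<in> M"
  unfolding sqrt_m3_squared by (intro subfield_uminus subfield_numeral)

lemma K: "is_subfield K"
  unfolding K_def by (rule is_subfield_adjoin_sqrt[OF L sqrt_m3_notin_L sqrt_m3_squared_in[OF L]])

lemma L_subset_K: "L \<subseteq> K"
  unfolding K_def by (rule subset_adjoin_sqrt[OF L sqrt_m3_notin_L sqrt_m3_squared_in[OF L]])

lemma r_in_K: "r \<in> K"
  using r_in_L L_subset_K by blast

lemma sqrt_m3_in_K: "sqrt_m3 \<in> K"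
  unfolding K_def by (rule in_adjoin_sqrt[OF L sqrt_m3_notin_L sqrt_m3_squared_in[OF L]])

lemma cubes_in_L: "\<alpha> ^ 3 \<in> L" "\<beta> ^ 3 \<in> L"
  unfolding \<alpha> \<beta>
  by (intro subfield_closed[OF L] r_in_L)+

lemma cubes_in_K: "\<alpha> ^ 3 \<in> K" "\<beta> ^ 3 \<in> K"
  using cubes_in_L L_subset_K by auto

lemma cube_descends_L: "x \<in> K \<Longrightarrow> x ^ 3 \<in> L \<Longrightarrow> \<exists>y\<in>L. y ^ 3 = x ^ 3"
  unfolding K_def by (rule cube_descends_sqrt[OF L sqrt_m3_notin_L sqrt_m3_squared_in[OF L]])

lemma cube_descends_Rats:
  assumes "x \<in> K" "x ^ 3 \<in> \<rat>"
  shows "\<exists>y\<in>\<rat>. y ^ 3 = x ^ 3"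
proof -
  obtain y where "y \<in> L" "y ^ 3 = x ^ 3"
    using cube_descends_L assms Rats_subset_L by blast
  then show ?thesis
    using cube_descends_sqrt[OF is_subfield_Rats r_notin_Rats r_squared_Rats, of y] assms
    by (simp add: L_def)
qed

text \<open>Every element \<open>p + q * r\<close> is a root of a rational quadratic, given by its
  trace \<open>2 * p\<close> and its norm; a root of \<open>f\<close> has no such equation.\<close>

lemma root_notin_L:
  assumes "z \<in> L"
  shows "poly (map_poly of_rat f) z \<noteq> 0"
proof
  assume 0: "poly (map_poly of_rat f) z = 0"
  obtain p q where "p \<in> \<rat>" "q \<in> \<rat>" and z: "z = p + q * r"
    using assms by (auto simp: L_def adjoin_sqrt_def)
  then obtain p' q' where rat: "p = of_rat p'" "q = of_rat q'"
    by (auto elim!: Rats_cases)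
  define g :: "rat poly" where "g = [:p' ^ 2 - q' ^ 2 * of_int \<Delta>, - 2 * p', 1:]"
  have "poly (map_poly of_rat g) z = p ^ 2 - q ^ 2 * r ^ 2 - 2 * p * z + z ^ 2"
    unfolding r rat g_def
    by (simp add: map_poly_pCons of_rat_diff of_rat_mult of_rat_power of_rat_minus of_rat_add power2_eq_square algebra_simps)
  also have "\<dots> = 0"
    unfolding z by (simp add: algebra_simps power2_eq_square)
  finally have "degree f \<le> degree g"
    using irred 0 by (intro irreducible_degree_le[where z = z]) (auto simp: g_def)
  then show False
    by (simp add: degree_f g_def)
qed

text \<open>A cube root in \<open>K\<close> would yield one in \<open>L\<close>, which would be a
  root of \<open>f\<close>.\<close>

lemma not_cubes_in_K:
  assumes "x \<in> K"
  shows "x ^ 3 \<noteq> \<alpha> ^ 3" "x ^ 3 \<noteq> \<beta> ^ 3"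
  using assms cube_descends_L[of x] cubes_in_L root_notin_L poly_f_eq_0_iff by metis+

lemma nonzero: "\<alpha> \<noteq> 0" "\<beta> \<noteq> 0"
  using not_cubes_in_K[OF subfield_0[OF K]] by auto

lemma b_nonzero: "b \<noteq> 0"
  using cubes_mult nonzero by auto

lemma r_nonzero: "r \<noteq> 0"
  using r_notin_Rats by auto

lemma cubes_neq: "\<alpha> ^ 3 \<noteq> \<beta> ^ 3"
  using cubes_diff r_nonzero by auto

text \<open>Extends the identity of \<open>\<rat>\<close> through both quadratic steps, with
  independent signs; the sign \<open>e\<close> of \<open>r\<close> decides whether
  \<open>\<alpha> ^ 3\<close> and \<open>\<beta> ^ 3\<close> are exchanged.\<close>

lemma hom_on_K:
  assumes "d \<in> {1, -1}" "e \<in> {1, -1::int}"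
  obtains \<phi> where "field_hom_on K \<phi>" "\<phi> r = of_int e * r" "\<phi> sqrt_m3 = of_int d * sqrt_m3"
    "\<phi> (\<alpha> ^ 3) = (if e = 1 then \<alpha> ^ 3 else \<beta> ^ 3)"
proof -
  have "field_hom_on \<rat> (\<lambda>x::complex. x)"
    by (auto simp: field_hom_on_def)
  moreover have "(of_int e * r) ^ 2 = r ^ 2"
    using assms by auto
  ultimately obtain \<phi> where \<phi>: "field_hom_on L \<phi>" "\<phi> r = of_int e * r"
    unfolding L_def using hom_extend_sqrt[OF is_subfield_Rats r_notin_Rats r_squared_Rats] by metis
  have "(of_int d * sqrt_m3) ^ 2 = \<phi> (sqrt_m3 ^ 2)"
    using assms unfolding sqrt_m3_squared
    by (auto simp: hom_uminus[OF L \<phi>(1)] hom_numeral[OF L \<phi>(1)] subfield_numeral[OF L] power_mult_distrib sqrt_m3_squared)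
  then obtain \<psi> where \<psi>: "field_hom_on K \<psi>" "\<And>x. x \<in> L \<Longrightarrow> \<psi> x = \<phi> x" "\<psi> sqrt_m3 = of_int d * sqrt_m3"
    unfolding K_def using hom_extend_sqrt[OF L sqrt_m3_notin_L sqrt_m3_squared_in[OF L] \<phi>(1)] by metis
  have \<psi>r: "\<psi> r = of_int e * r"
    using \<psi>(2)[OF r_in_L] \<phi>(2) by simp
  have "\<psi> (\<alpha> ^ 3) = (- of_int a + of_int e * r) / 2"
    unfolding \<alpha> using r_in_K \<psi>r
    by (simp add: hom_simps[OF K \<psi>(1)] subfield_closed[OF K])
  then have "\<psi> (\<alpha> ^ 3) = (if e = 1 then \<alpha> ^ 3 else \<beta> ^ 3)"
    using assms(2) by (auto simp: \<alpha> \<beta>)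
  with that \<psi> \<psi>r show thesis by blast
qed

lemma S: "is_subfield S"
  by (rule is_subfield_splitting_field)

lemma roots_subset:
  assumes "is_subfield M" "sqrt_m3 \<in> M" "\<alpha> \<in> M" "\<beta> \<in> M"
  shows "rat_roots f \<subseteq> M"
  using cube_roots_in_subfield[OF assms(1,2)] assms(3,4) by (auto simp: poly_f_eq_0_iff)

lemma S_subset:
  assumes "is_subfield M" "sqrt_m3 \<in> M" "\<alpha> \<in> M" "\<beta> \<in> M"
  shows "S \<subseteq> M"
  using splitting_field_subset[OF assms(1) roots_subset[OF assms]] .

lemma roots_in_S: "\<alpha> \<in> S" "\<beta> \<in> S"
  using roots_subset_splitting_field[of f] by (auto simp: poly_f_eq_0_iff)

text \<open>A quotient of the two roots \<open>omega * \<alpha>\<close> and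
  \<open>\<alpha>\<close>.\<close>

lemma omega_in_S: "omega \<in> S"
proof -
  have "omega * \<alpha> \<in> S"
    using roots_subset_splitting_field[of f]
    by (auto simp: poly_f_eq_0_iff power_mult_distrib omega_cubed)
  then have "omega * \<alpha> / \<alpha> \<in> S"
    using roots_in_S by (intro subfield_divide[OF S])
  then show ?thesis
    using nonzero by simp
qed

lemma sqrt_m3_in_S: "sqrt_m3 \<in> S"
  unfolding sqrt_m3_eq by (intro subfield_closed[OF S] omega_in_S)

lemma cardano_in_S: "x \<in> S \<Longrightarrow> y \<in> S \<Longrightarrow> cardano x y j \<in> S"
  unfolding cardano_def by (intro subfield_closed[OF S] omega_in_S)

lemma galois_hom: "\<sigma> \<in> carrier G \<Longrightarrow> field_hom_on S \<sigma>"
  by (simp add: galois_group_carrier)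

lemma galois_sqrt_m3:
  assumes "\<sigma> \<in> carrier G"
  shows "\<sigma> sqrt_m3 = sqrt_m3 \<or> \<sigma> sqrt_m3 = - sqrt_m3"
proof -
  note \<sigma> = galois_hom[OF assms]
  have "\<sigma> (sqrt_m3 ^ 2) = \<sigma> (- 3)"
    by (simp add: sqrt_m3_squared)
  then have "(\<sigma> sqrt_m3) ^ 2 = - 3"
    by (simp add: hom_power[OF S \<sigma>] sqrt_m3_in_S hom_uminus[OF S \<sigma>] hom_numeral[OF S \<sigma>] subfield_numeral[OF S])
  then show ?thesis
    by (simp add: power2_eq_iff flip: sqrt_m3_squared)
qed

lemma restrict_in_G:
  assumes "field_hom_on M \<phi>" "is_subfield M" "sqrt_m3 \<in> M" "\<alpha> \<in> M" "\<beta> \<in> M"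
  shows "restrict \<phi> S \<in> carrier G"
  by (intro restrict_in_galois_group f_nonzero field_hom_on_subset[OF assms(1)] S_subset assms)

lemma alpha_not_cube: "\<forall>x\<in>K. x ^ 3 \<noteq> \<alpha> ^ 3"
  using not_cubes_in_K by blast

subsection \<open>The dihedral cases\<close>

text \<open>Two signs and three choices of \<open>y\<close> give twelve embeddings, as many as
  \<open>dihedral_group 6\<close> has elements.\<close>

lemma hom_on_K_alpha:
  assumes de: "d \<in> {1, -1}" "e \<in> {1, -1::int}" and y: "y ^ 3 = (if e = 1 then \<alpha> ^ 3 else \<beta> ^ 3)"
  obtains \<phi> where "field_hom_on (adjoin_cbrt K \<alpha>) \<phi>" "\<phi> sqrt_m3 = of_int d * sqrt_m3" "\<phi> \<alpha> = y"
proof -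
  obtain \<phi> where \<phi>: "field_hom_on K \<phi>" "\<phi> r = of_int e * r" "\<phi> sqrt_m3 = of_int d * sqrt_m3"
      "\<phi> (\<alpha> ^ 3) = (if e = 1 then \<alpha> ^ 3 else \<beta> ^ 3)"
    using hom_on_K[OF de] .
  then obtain \<psi> where "field_hom_on (adjoin_cbrt K \<alpha>) \<psi>" "\<And>x. x \<in> K \<Longrightarrow> \<psi> x = \<phi> x" "\<psi> \<alpha> = y"
    using hom_extend_cbrt[OF K cubes_in_K(1) alpha_not_cube \<phi>(1), of y] y by auto
  with that \<phi>(3) sqrt_m3_in_K show thesis by simp
qed

lemma K_alpha: "is_subfield (adjoin_cbrt K \<alpha>)" "sqrt_m3 \<in> adjoin_cbrt K \<alpha>" "\<alpha> \<in> adjoin_cbrt K \<alpha>"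
  using is_subfield_adjoin_cbrt[OF K cubes_in_K(1) alpha_not_cube]
    subset_adjoin_cbrt[OF K cubes_in_K(1) alpha_not_cube]
    in_adjoin_cbrt[OF K cubes_in_K(1) alpha_not_cube] sqrt_m3_in_K
  by auto

text \<open>Since \<open>\<alpha> * \<beta>\<close> is an integer, the numbers
  \<open>cardano \<alpha> \<beta> j\<close> are the roots of the rational cubic
  \<open>x ^ 3 - 3 * c * x + a\<close>, which the Galois group permutes.\<close>

theorem galois_group_cube:
  assumes c: "\<alpha> * \<beta> = of_int c"
  shows "G \<cong> dihedral_group 6"
proof -
  define s where "s = cardano \<alpha> \<beta>"
  define sg :: "int \<Rightarrow> int" where "sg k = (if even k then 1 else -1)" for k
  \<comment> \<open>Modulo 3, \<open>k\<close> is the translation of the indices; modulo 2, it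
    records the sign on \<open>sqrt_m3\<close>.\<close>
  define R where "R \<sigma> h \<longleftrightarrow> (case h of (k, e) \<Rightarrow>
    \<sigma> sqrt_m3 = of_int (sg k) * sqrt_m3 \<and> (\<forall>j. \<sigma> (s j) = s (e * j + k)))"
    for \<sigma> :: "complex \<Rightarrow> complex" and h :: "int \<times> int"
  have s_in: "s j \<in> S" for j
    unfolding s_def by (intro cardano_in_S roots_in_S)
  have s_eq_iff: "s i = s j \<longleftrightarrow> [i = j] (mod 3)" for i j
    unfolding s_def by (rule cardano_eq_iff[OF cubes_neq])
  have sqrt_m3_nz: "sqrt_m3 \<noteq> 0"
    using sqrt_m3_squared by auto
  show ?thesis
  proof (rule galois_group_iso[where R = R])
    fix \<sigma> assume \<sigma>: "\<sigma> \<in> carrier G"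
    obtain e k where ek: "e \<in> {1, -1}" "\<And>j. \<sigma> (s j) = s (e * j + k)"
      using hom_affine_cardano[OF S galois_hom[OF \<sigma>], of \<alpha> \<beta>] c cubes_add cubes_neq
        cardano_in_S[OF roots_in_S] unfolding s_def by auto
    obtain p :: int where p: "\<sigma> sqrt_m3 = of_int (sg p) * sqrt_m3"
      using galois_sqrt_m3[OF \<sigma>] that[of 0] that[of 1] by (auto simp: sg_def)
    obtain m where m: "0 \<le> m" "m < 6" "[k = m] (mod 3)" "even m \<longleftrightarrow> even p"
      by (rule mod_6_choice)
    have "sg m = sg p"
      using m(4) by (simp add: sg_def)
    moreover have "s (e * j + k) = s (e * j + m)" for j
      unfolding s_eq_iff by (intro cong_add cong_refl m(3))
    ultimately have "R \<sigma> (m, e)"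
      using p ek by (simp add: R_def)
    moreover have "(m, e) \<in> carrier (dihedral_group 6)"
      using ek m by (auto simp: dihedral_group_def)
    ultimately show "\<exists>h\<in>carrier (dihedral_group 6). R \<sigma> h"
      by blast
  next
    fix \<sigma> h h'
    assume hh: "h \<in> carrier (dihedral_group 6)" "h' \<in> carrier (dihedral_group 6)" and R: "R \<sigma> h" "R \<sigma> h'"
    obtain k e k' e' where h: "h = (k, e)" "h' = (k', e')"
      by (cases h; cases h')
    have range: "0 \<le> k" "k < 6" "0 \<le> k'" "k' < 6" "e = 1 \<or> e = -1" "e' = 1 \<or> e' = -1"
      using hh by (auto simp: h dihedral_group_def)
    have R1: "\<sigma> sqrt_m3 = of_int (sg k) * sqrt_m3" "\<sigma> (s j) = s (e * j + k)"
      and R2: "\<sigma> sqrt_m3 = of_int (sg k') * sqrt_m3" "\<sigma> (s j) = s (e' * j + k')" for j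
      using R unfolding R_def h by simp_all
    note sg = trans[OF R1(1) [symmetric] R2(1)] and s = trans[OF R1(2) [symmetric] R2(2)]
    \<comment> \<open>The sign on \<open>sqrt_m3\<close> determines the parity of \<open>k\<close>,
      index 0 determines \<open>k\<close> modulo 3, and index 1 then determines
      \<open>e\<close>.\<close>
    have "even k \<longleftrightarrow> even k'"
      using sg unfolding mult_right_cancel[OF sqrt_m3_nz] of_int_eq_iff by (simp add: sg_def split: if_splits)
    moreover have "[k = k'] (mod 3)"
      using s[of 0] by (simp add: s_eq_iff)
    ultimately have "[k = k'] (mod 6)"
      by (simp add: cong_6_iff)
    then have k: "k = k'"
      using range by (simp add: cong_def)
    have "[e + k = e' + k'] (mod 3)"
      using s[of 1] by (simp add: s_eq_iff)
    then have "e = e'"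
      using range by (intro sign_cong_3) (auto simp: k cong_add_rcancel)
    with k show "h = h'"
      by (simp add: h)
  next
    fix h assume "h \<in> carrier (dihedral_group 6)"
    then obtain k e where h: "h = (k, e)" and e: "e \<in> {1, -1}"
      by (auto simp: dihedral_group_def)
    define d where "d = sg k"
    have d: "d \<in> {1, -1}"
      by (simp add: d_def sg_def)
    have de: "e * d \<in> {1, -1}"
      using d e by auto
    \<comment> \<open>The slope is the product of the signs on \<open>r\<close> and
      \<open>sqrt_m3\<close>, so slope \<open>e\<close> calls for the sign \<open>e * d\<close> on
      \<open>r\<close>. The intended images of \<open>\<alpha>\<close> and \<open>\<beta>\<close>
      are \<open>y\<close> and \<open>z\<close>, whose product is again \<open>c\<close>.\<close>
    define y z where "y = (if e * d = 1 then omega powi k * \<alpha> else omega powi (- k) * \<beta>)"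
      and "z = (if e * d = 1 then omega powi (- k) * \<beta> else omega powi k * \<alpha>)"
    have "y ^ 3 = (if e * d = 1 then \<alpha> ^ 3 else \<beta> ^ 3)"
      by (simp add: y_def power_mult_distrib omega_powi_cubed)
    then obtain \<phi> where \<phi>: "field_hom_on (adjoin_cbrt K \<alpha>) \<phi>" "\<phi> sqrt_m3 = of_int d * sqrt_m3" "\<phi> \<alpha> = y"
      using hom_on_K_alpha[OF d de] by metis
    have \<beta>_eq: "\<beta> = of_int c / \<alpha>"
      using c nonzero by (simp add: field_simps)
    have \<beta>_in: "\<beta> \<in> adjoin_cbrt K \<alpha>"
      unfolding \<beta>_eq by (intro subfield_closed[OF K_alpha(1)] K_alpha(3))
    have "\<phi> \<beta> = of_int c / y"
      unfolding \<beta>_eq \<phi>(3) [symmetric]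
      by (simp add: hom_divide[OF K_alpha(1) \<phi>(1)] hom_of_int[OF K_alpha(1) \<phi>(1)]
        subfield_of_int[OF K_alpha(1)] K_alpha(3))
    also have "of_int c = y * z"
      unfolding c [symmetric] using omega_nonzero by (simp add: y_def z_def power_int_minus)
    also have "y * z / y = z"
      using nonzero omega_nonzero by (simp add: y_def)
    finally have \<phi>\<beta>: "\<phi> \<beta> = z" .
    have *: "\<phi> (s j) = s (e * d * d * j + k)" for j
      unfolding s_def using \<phi> \<phi>\<beta>
      by (intro hom_twist_cardano[OF K_alpha(1) \<phi>(1) K_alpha(2,3) \<beta>_in d _ de]) (simp_all add: y_def z_def)
    have edd: "e * d * d = e"
      using d by auto
    have "\<phi> (s j) = s (e * j + k)" for j
      using *[of j] unfolding edd .
    then have "R (restrict \<phi> S) h"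
      using \<phi>(2) s_in sqrt_m3_in_S by (simp add: R_def h d_def)
    moreover have "restrict \<phi> S \<in> carrier G"
      by (intro restrict_in_G[OF \<phi>(1)] K_alpha \<beta>_in)
    ultimately show "\<exists>\<sigma>\<in>carrier G. R \<sigma> h"
      by blast
  next
    fix \<sigma> \<tau> h
    assume \<sigma>: "\<sigma> \<in> carrier G" "\<tau> \<in> carrier G" and R: "R \<sigma> h" "R \<tau> h"
    show "\<sigma> = \<tau>"
    proof (rule galois_group_eqI[OF \<sigma>, where A = "insert sqrt_m3 (range s)"])
      show "insert sqrt_m3 (range s) \<subseteq> S"
        using s_in sqrt_m3_in_S by auto
      show "\<sigma> x = \<tau> x" if "x \<in> insert sqrt_m3 (range s)" for x
        using that R by (cases h) (auto simp: R_def)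
      fix M assume M: "is_subfield M" "insert sqrt_m3 (range s) \<subseteq> M"
      then have M': "sqrt_m3 \<in> M" "s 1 \<in> M" "s 3 \<in> M"
        by auto
      show "rat_roots f \<subseteq> M"
        by (intro roots_subset M(1) M'(1) cardano_generators[OF M(1) M'[unfolded s_def]])
    qed
  next
    fix \<sigma> \<tau> h h'
    assume \<sigma>: "\<sigma> \<in> carrier G" "\<tau> \<in> carrier G"
      and h: "h \<in> carrier (dihedral_group 6)" "h' \<in> carrier (dihedral_group 6)" and R: "R \<sigma> h" "R \<tau> h'"
    obtain k e l d where ke: "h = (k, e)" "h' = (l, d)"
      by (cases h; cases h')
    have ed: "e \<in> {1, -1}" "d \<in> {1, -1}"
      using h by (auto simp: ke dihedral_group_def)
    define m where "m = (k + e * l) mod 6"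
    have mult: "h \<otimes>\<^bsub>dihedral_group 6\<^esub> h' = (m, e * d)"
      by (simp add: ke dihedral_group_def m_def)
    have m_in: "(m, e * d) \<in> carrier (dihedral_group 6)"
      using ed by (auto simp: dihedral_group_def m_def)
    have "even m \<longleftrightarrow> even (k + e * l)"
      by (simp add: m_def dvd_mod_iff)
    \<comment> \<open>Reduction modulo 6 keeps the parity and \<open>e\<close> is odd, so
      \<open>m\<close> has the parity of \<open>k + l\<close>.\<close>
    then have "sg m = sg k * sg l"
      using ed by (auto simp: sg_def)
    moreover have "\<sigma> (of_int (sg l) * sqrt_m3) = of_int (sg l) * \<sigma> sqrt_m3"
      using galois_hom[OF \<sigma>(1)]
      by (simp add: hom_mult[OF S] hom_of_int[OF S] subfield_of_int[OF S] sqrt_m3_in_S)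
    moreover have "[e * (d * j + l) + k = e * d * j + m] (mod 3)" for j
    proof -
      have "[k + e * l = m] (mod 3)"
        by (simp add: m_def cong_def mod_mod_cancel)
      then have "[e * d * j + (k + e * l) = e * d * j + m] (mod 3)"
        by (intro cong_add cong_refl)
      then show ?thesis
        by (simp add: algebra_simps)
    qed
    then have "s (e * (d * j + l) + k) = s (e * d * j + m)" for j
      by (simp add: s_eq_iff)
    ultimately have "R (compose S \<sigma> \<tau>) (m, e * d)"
      using R s_in sqrt_m3_in_S by (simp add: R_def ke compose_def)
    with mult m_in show "h \<otimes>\<^bsub>dihedral_group 6\<^esub> h' \<in> carrier (dihedral_group 6) \<and>
        R (compose S \<sigma> \<tau>) (h \<otimes>\<^bsub>dihedral_group 6\<^esub> h')"
      by simp
  qed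
qed

end

section \<open>Powers of the primitive sixth root of unity \<open>- omega\<close>\<close>

lemma minus_omega_powi: "(- omega) powi k = of_int (if even k then 1 else -1) * omega powi k"
  by (simp add: power_int_minus_left)

text \<open>Cubing removes the power of \<open>omega\<close> and leaves the sign, hence the parity
  of the exponent; the powers of \<open>omega\<close> give the exponent modulo 3.\<close>

lemma minus_omega_powi_eq_iff: "(- omega) powi k = (- omega) powi l \<longleftrightarrow> [k = l] (mod 6)"
proof
  assume eq: "(- omega) powi k = (- omega) powi l"
  then have "((- omega) powi k) ^ 3 = ((- omega) powi l) ^ 3"
    by simp
  then have par: "even k \<longleftrightarrow> even l"
    unfolding minus_omega_powi by (auto simp: power_mult_distrib omega_powi_cubed split: if_splits)
  then have "omega powi k = omega powi l"
    using eq by (auto simp: minus_omega_powi split: if_splits)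
  with par show "[k = l] (mod 6)"
    by (simp add: cong_6_iff omega_powi_eq_iff)
next
  assume "[k = l] (mod 6)"
  then have "even k \<longleftrightarrow> even l" "omega powi k = omega powi l"
    by (simp_all add: cong_6_iff omega_powi_eq_iff)
  then show "(- omega) powi k = (- omega) powi l"
    by (simp add: minus_omega_powi)
qed

context sextic
begin

theorem galois_group_pure:
  assumes a: "a = 0" and \<beta>_eq: "\<beta> = - \<alpha>"
  shows "G \<cong> dihedral_group 6"
proof -
  define z where "z k = (- omega) powi k" for k :: int
  define R where "R \<sigma> h \<longleftrightarrow> (case h of (k, e) \<Rightarrow>
    \<sigma> \<alpha> = z k * \<alpha> \<and> \<sigma> sqrt_m3 = of_int e * sqrt_m3)"
    for \<sigma> :: "complex \<Rightarrow> complex" and h :: "int \<times> int"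
  have sqrt_m3_nz: "sqrt_m3 \<noteq> 0"
    using sqrt_m3_squared by auto
  have z_eq_iff: "z k = z l \<longleftrightarrow> [k = l] (mod 6)" for k l
    by (simp add: z_def minus_omega_powi_eq_iff)
  have z_in: "z k \<in> S" for k
    unfolding z_def by (intro subfield_closed[OF S] omega_in_S)
  have z_add: "z (k + l) = z k * z l" for k l
    using omega_nonzero by (simp add: z_def power_int_add)
  have hom_z: "\<sigma> (z k) = z (e * k)"
    if \<sigma>: "\<sigma> \<in> carrier G" and e: "e \<in> {1, -1}" "\<sigma> sqrt_m3 = of_int e * sqrt_m3" for \<sigma> e k
  proof -
    note hom = galois_hom[OF \<sigma>]
    have 1: "(1::complex) \<in> S"
      by (rule subfield_1[OF S])
    \<comment> \<open>\<open>omega\<close> is \<open>cardano 1 0 1\<close>, so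
      \<open>hom_cardano\<close> yields its image.\<close>
    have "\<sigma> (cardano 1 0 1) = cardano 1 0 (e * 1)"
      using hom_cardano[OF S hom sqrt_m3_in_S 1 subfield_0[OF S] e, of 1]
      by (simp add: hom_0[OF S hom] hom_1[OF S hom])
    then have "\<sigma> omega = omega powi e"
      by (simp add: cardano_0_right)
    moreover have "- (omega powi e) = (- omega) powi e"
      using e(1) by (auto simp: power_int_minus)
    ultimately have "\<sigma> (- omega) = (- omega) powi e"
      using omega_in_S by (simp add: hom_uminus[OF S hom])
    then show ?thesis
      unfolding z_def
      by (simp add: hom_power_int[OF S hom] subfield_uminus[OF S] omega_in_S power_int_mult)
  qed
  show ?thesis
  proof (rule galois_group_iso[where R = R])
    fix \<sigma> assume \<sigma>: "\<sigma> \<in> carrier G"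
    note hom = galois_hom[OF \<sigma>]
    obtain e :: int where e: "e \<in> {1, -1}" "\<sigma> sqrt_m3 = of_int e * sqrt_m3"
      using galois_sqrt_m3[OF \<sigma>] that[of 1] that[of "-1"] by auto
    have "\<alpha> ^ 3 * \<beta> ^ 3 = - (\<alpha> ^ 6)"
      by (simp add: \<beta>_eq flip: power_add)
    then have "\<alpha> ^ 6 = of_int (- b)"
      by (simp add: cubes_mult)
    then have "(\<sigma> \<alpha>) ^ 6 = \<alpha> ^ 6"
      using roots_in_S by (metis hom_power[OF S hom] hom_of_int[OF S hom])
    then have "((\<sigma> \<alpha>) ^ 3) ^ 2 = (\<alpha> ^ 3) ^ 2"
      by (simp flip: power_mult)
    \<comment> \<open>The sixth power of \<open>\<alpha>\<close> is an integer, so the cube of its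
      image is \<open>\<alpha> ^ 3\<close> up to sign; the parity of \<open>p\<close> encodes that
      sign.\<close>
    then obtain p :: int where p: "(\<sigma> \<alpha>) ^ 3 = (of_int (if even p then 1 else -1) * \<alpha>) ^ 3"
      unfolding power2_eq_iff using that[of 0] that[of 1] by auto
    then obtain j :: nat where j: "\<sigma> \<alpha> = omega powi (int j) * (of_int (if even p then 1 else -1) * \<alpha>)"
      using cardano_root[of "\<sigma> \<alpha>" "of_int (if even p then 1 else -1) * \<alpha>" 0]
      unfolding cardano_0_right by auto
    obtain k where k: "0 \<le> k" "k < 6" "[int j = k] (mod 3)" "even k \<longleftrightarrow> even p"
      by (rule mod_6_choice)
    have "z k = of_int (if even p then 1 else -1) * omega powi (int j)"
      using k(4) omega_powi_cong[OF k(3)] by (simp add: z_def minus_omega_powi)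
    with j have "R \<sigma> (k, e)"
      using e by (simp add: R_def)
    moreover have "(k, e) \<in> carrier (dihedral_group 6)"
      using e k by (auto simp: dihedral_group_def)
    ultimately show "\<exists>h\<in>carrier (dihedral_group 6). R \<sigma> h"
      by blast
  next
    fix \<sigma> h h'
    assume hh: "h \<in> carrier (dihedral_group 6)" "h' \<in> carrier (dihedral_group 6)" and R: "R \<sigma> h" "R \<sigma> h'"
    obtain k e k' e' where h: "h = (k, e)" "h' = (k', e')"
      by (cases h; cases h')
    have range: "0 \<le> k" "k < 6" "0 \<le> k'" "k' < 6"
      using hh by (auto simp: h dihedral_group_def)
    have R1: "\<sigma> \<alpha> = z k * \<alpha>" "\<sigma> sqrt_m3 = of_int e * sqrt_m3"
      and R2: "\<sigma> \<alpha> = z k' * \<alpha>" "\<sigma> sqrt_m3 = of_int e' * sqrt_m3"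
      using R unfolding R_def h by simp_all
    have "e = e'"
      using trans[OF R1(2) [symmetric] R2(2)] unfolding mult_right_cancel[OF sqrt_m3_nz] of_int_eq_iff .
    moreover have "z k = z k'"
      using trans[OF R1(1) [symmetric] R2(1)] unfolding mult_right_cancel[OF nonzero(1)] .
    then have "k = k'"
      using range by (simp add: z_eq_iff cong_def)
    ultimately show "h = h'"
      by (simp add: h)
  next
    fix h assume "h \<in> carrier (dihedral_group 6)"
    then obtain k e where h: "h = (k, e)" and e: "e \<in> {1, -1}"
      by (auto simp: dihedral_group_def)
    \<comment> \<open>The cube of \<open>z k\<close> is \<open>d\<close>, and
      \<open>\<beta> ^ 3 = - (\<alpha> ^ 3)\<close>; thus \<open>d\<close> is the sign required on
      \<open>r\<close>.\<close>
    define d :: int where "d = (if even k then 1 else -1)"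
    have d: "d \<in> {1, -1}"
      by (simp add: d_def)
    have "(z k * \<alpha>) ^ 3 = (if d = 1 then \<alpha> ^ 3 else \<beta> ^ 3)"
      by (simp add: z_def minus_omega_powi d_def power_mult_distrib omega_powi_cubed \<beta>_eq)
    then obtain \<phi> where \<phi>: "field_hom_on (adjoin_cbrt K \<alpha>) \<phi>" "\<phi> sqrt_m3 = of_int e * sqrt_m3"
        "\<phi> \<alpha> = z k * \<alpha>"
      using hom_on_K_alpha[OF e d] by metis
    have "R (restrict \<phi> S) h"
      using \<phi> roots_in_S sqrt_m3_in_S by (simp add: R_def h)
    moreover have "restrict \<phi> S \<in> carrier G"
      unfolding \<beta>_eq by (intro restrict_in_G[OF \<phi>(1)] K_alpha)
        (auto simp: \<beta>_eq intro: subfield_uminus K_alpha)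
    ultimately show "\<exists>\<sigma>\<in>carrier G. R \<sigma> h"
      by blast
  next
    fix \<sigma> \<tau> h
    assume \<sigma>: "\<sigma> \<in> carrier G" "\<tau> \<in> carrier G" and R: "R \<sigma> h" "R \<tau> h"
    show "\<sigma> = \<tau>"
    proof (rule galois_group_eqI[OF \<sigma>, where A = "{sqrt_m3, \<alpha>}"])
      show "{sqrt_m3, \<alpha>} \<subseteq> S"
        using roots_in_S sqrt_m3_in_S by auto
      show "\<sigma> x = \<tau> x" if "x \<in> {sqrt_m3, \<alpha>}" for x
        using that R by (cases h) (auto simp: R_def)
      fix M assume M: "is_subfield M" "{sqrt_m3, \<alpha>} \<subseteq> M"
      then show "rat_roots f \<subseteq> M"
        by (intro roots_subset M(1)) (auto simp: \<beta>_eq subfield_uminus)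
    qed
  next
    fix \<sigma> \<tau> h h'
    assume \<sigma>: "\<sigma> \<in> carrier G" "\<tau> \<in> carrier G"
      and h: "h \<in> carrier (dihedral_group 6)" "h' \<in> carrier (dihedral_group 6)" and R: "R \<sigma> h" "R \<tau> h'"
    obtain k e l d where ke: "h = (k, e)" "h' = (l, d)"
      by (cases h; cases h')
    have ed: "e \<in> {1, -1}" "d \<in> {1, -1}"
      using h by (auto simp: ke dihedral_group_def)
    define m where "m = (k + e * l) mod 6"
    have mult: "h \<otimes>\<^bsub>dihedral_group 6\<^esub> h' = (m, e * d)"
      by (simp add: ke dihedral_group_def m_def)
    have m_in: "(m, e * d) \<in> carrier (dihedral_group 6)"
      using ed by (auto simp: dihedral_group_def m_def)
    have R1: "\<sigma> \<alpha> = z k * \<alpha>" "\<sigma> sqrt_m3 = of_int e * sqrt_m3"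
      and R2: "\<tau> \<alpha> = z l * \<alpha>" "\<tau> sqrt_m3 = of_int d * sqrt_m3"
      using R unfolding R_def ke by simp_all
    note hom = galois_hom[OF \<sigma>(1)]
    \<comment> \<open>For \<open>e = -1\<close> the sixth root of unity is inverted, which is the
      twist \<open>k + e * l\<close> in the dihedral product.\<close>
    have "\<sigma> (z l * \<alpha>) = z (e * l) * (z k * \<alpha>)"
      using hom_z[OF \<sigma>(1) ed(1) R1(2)] R1(1) by (simp add: hom_mult[OF S hom] z_in roots_in_S)
    also have "\<dots> = z (k + e * l) * \<alpha>"
      by (simp add: z_add)
    also have "z (k + e * l) = z m"
      by (simp add: z_eq_iff m_def cong_def)
    finally have "\<sigma> (z l * \<alpha>) = z m * \<alpha>" .
    moreover have "\<sigma> (of_int d * sqrt_m3) = of_int (e * d) * sqrt_m3"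
      by (simp add: hom_mult[OF S hom] hom_of_int[OF S hom] subfield_of_int[OF S] sqrt_m3_in_S R1)
    ultimately have "R (compose S \<sigma> \<tau>) (m, e * d)"
      using R2 roots_in_S sqrt_m3_in_S by (simp add: R_def compose_def)
    with mult m_in show "h \<otimes>\<^bsub>dihedral_group 6\<^esub> h' \<in> carrier (dihedral_group 6) \<and>
        R (compose S \<sigma> \<tau>) (h \<otimes>\<^bsub>dihedral_group 6\<^esub> h')"
      by simp
  qed
qed

subsection \<open>The generic case\<close>

text \<open>Descend to a cube root \<open>x = p + q * r\<close> in \<open>L\<close>. Its norm is
  \<open>b\<close>, and its trace \<open>s = 2 * p\<close> satisfies the cubic, because the trace of
  \<open>x ^ 3\<close> is both \<open>s ^ 3 - 3 * b * s\<close> and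
  \<open>- (a * b)\<close>.\<close>

lemma cube_b_in_K:
  assumes y: "y \<in> K" "y ^ 3 = of_int b * \<alpha> ^ 3"
  shows "\<exists>s::rat. s ^ 3 - 3 * of_int b * s + of_int (a * b) = 0"
proof -
  have "y ^ 3 \<in> L"
    unfolding y(2) by (intro subfield_closed[OF L] cubes_in_L)
  then obtain x where x: "x \<in> L" "x ^ 3 = of_int b * \<alpha> ^ 3"
    using cube_descends_L[OF y(1)] y(2) by auto
  then obtain p q where pq: "p \<in> \<rat>" "q \<in> \<rat>" "x = p + q * r"
    by (auto simp: L_def adjoin_sqrt_def)
  then obtain p' q' where rat: "p = of_rat p'" "q = of_rat q'"
    by (auto elim!: Rats_cases)
  define A B where "A = p' ^ 3 + 3 * p' * q' ^ 2 * of_int \<Delta>" and "B = 3 * p' ^ 2 * q' + q' ^ 3 * of_int \<Delta>"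
  have "x ^ 3 = (p ^ 3 + 3 * p * q ^ 2 * r ^ 2) + (3 * p ^ 2 * q + q ^ 3 * r ^ 2) * r"
    unfolding pq(3) by (simp add: algebra_simps power2_eq_square power3_eq_cube)
  also have "\<dots> = of_rat A + of_rat B * r"
    unfolding rat r A_def B_def by (simp add: of_rat_add of_rat_mult of_rat_power of_rat_diff)
  finally have eq: "of_rat A + of_rat B * r = of_rat (- of_int (a * b) / 2) + of_rat (of_int b / 2) * r"
    unfolding x(2) \<alpha> by (simp add: of_rat_divide of_rat_minus of_rat_mult algebra_simps)
  have "(of_rat A :: complex) = of_rat (- of_int (a * b) / 2)" "(of_rat B :: complex) = of_rat (of_int b / 2)"
    using unique_L[OF Rats_of_rat Rats_of_rat Rats_of_rat Rats_of_rat eq] .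
  then have AB: "A = - of_int (a * b) / 2" "B = of_int b / 2"
    by (simp_all only: of_rat_eq_iff)
  \<comment> \<open>Multiplicativity of the norm: the cube of the norm of \<open>x\<close> is the
    norm of \<open>x ^ 3\<close>, and real cube roots are unique.\<close>
  have "(p' ^ 2 - q' ^ 2 * of_int \<Delta>) ^ 3 = A ^ 2 - of_int \<Delta> * B ^ 2"
    unfolding A_def B_def by (simp only: power2_eq_square power3_eq_cube) Groebner_Basis.algebra
  also have "\<dots> = of_int b ^ 3"
    unfolding AB by (simp add: power2_eq_square power3_eq_cube field_simps)
  finally have N: "p' ^ 2 - q' ^ 2 * of_int \<Delta> = of_int b"
    by (rule rat_cube_inj)
  have "(2 * p') ^ 3 - 3 * (p' ^ 2 - q' ^ 2 * of_int \<Delta>) * (2 * p') - 2 * A = 0"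
    unfolding A_def by (simp only: power2_eq_square power3_eq_cube) Groebner_Basis.algebra
  then have "(2 * p') ^ 3 - 3 * of_int b * (2 * p') + of_int (a * b) = 0"
    unfolding N AB by simp
  then show ?thesis by blast
qed

text \<open>Over \<open>K\<close> the two hypotheses prevent \<open>b\<close> and
  \<open>b * \<alpha> ^ 3\<close> from being cubes. Adjoining first \<open>t\<close>, then
  \<open>w\<close>, gives two successive cubic steps, with \<open>\<alpha>\<close> and
  \<open>\<beta>\<close> recovered as \<open>t / w\<close> and \<open>t' / w\<close>.\<close>

theorem galois_group_generic:
  assumes not_cube: "\<And>q::rat. q ^ 3 \<noteq> of_int b"
    and no_root: "\<And>s::rat. s ^ 3 - 3 * of_int b * s + of_int (a * b) \<noteq> 0"
  shows "G \<cong> sym_group 3 \<times>\<times> sym_group 3"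
proof -
  define w t t' where "w = \<alpha> * \<beta>" and "t = \<alpha> ^ 2 * \<beta>" and "t' = \<alpha> * \<beta> ^ 2"
  have w_cube: "w ^ 3 = of_int b"
    by (simp add: w_def power_mult_distrib cubes_mult)
  have t_cube: "t ^ 3 = of_int b * \<alpha> ^ 3"
    unfolding t_def cubes_mult [symmetric] by (simp add: power_mult_distrib flip: power_mult power_add)
  have t'_cube: "t' ^ 3 = of_int b * \<beta> ^ 3"
    unfolding t'_def cubes_mult [symmetric] by (simp add: power_mult_distrib flip: power_mult power_add)
  have tt': "t * t' = of_int b"
    unfolding t_def t'_def cubes_mult [symmetric] by (simp add: power2_eq_square power3_eq_cube)
  have nz: "w \<noteq> 0" "t \<noteq> 0" "t' \<noteq> 0"
    using nonzero by (simp_all add: w_def t_def t'_def)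
  have \<alpha>_eq: "\<alpha> = t / w" and \<beta>_eq: "\<beta> = t' / w"
    using nonzero by (simp_all add: w_def t_def t'_def power2_eq_square)
  have w_ne: "w ^ 3 \<noteq> 0 ^ 3"
    using nz by simp
  have t_ne: "t ^ 3 \<noteq> t' ^ 3"
    unfolding t_cube t'_cube using cubes_neq b_nonzero by simp
  have t_add: "t ^ 3 + t' ^ 3 = of_int (- (a * b))"
    unfolding t_cube t'_cube distrib_left [symmetric] cubes_add by simp

  have t_K: "t ^ 3 \<in> K" "\<forall>x\<in>K. x ^ 3 \<noteq> t ^ 3"
    using cube_b_in_K no_root subfield_closed[OF K] cubes_in_K unfolding t_cube by metis+
  define T where "T = adjoin_cbrt K t"
  have T: "is_subfield T" "K \<subseteq> T" "t \<in> T"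
    unfolding T_def using is_subfield_adjoin_cbrt[OF K t_K] subset_adjoin_cbrt[OF K t_K]
      in_adjoin_cbrt[OF K t_K] by auto
  have w_T: "w ^ 3 \<in> T" "\<forall>x\<in>T. x ^ 3 \<noteq> w ^ 3"
  proof -
    show "w ^ 3 \<in> T"
      unfolding w_cube by (rule subfield_of_int[OF T(1)])
    show "\<forall>x\<in>T. x ^ 3 \<noteq> w ^ 3"
    proof (intro ballI notI)
      fix x assume x: "x \<in> T" "x ^ 3 = w ^ 3"
      have "x ^ 3 \<in> K"
        unfolding x(2) w_cube by (rule subfield_of_int[OF K])
      then obtain y where y: "y \<in> K"
        and cases: "x ^ 3 = y ^ 3 \<or> x ^ 3 = y ^ 3 * t ^ 3 \<or> x ^ 3 = y ^ 3 * (t ^ 3) ^ 2"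
        using cube_in_adjoin_cbrt[OF K t_K, of x] x(1) by (auto simp: T_def)
      define u where "u = \<alpha> ^ 3"
      define B :: complex where "B = of_int b"
      have B: "B \<noteq> 0" "u * \<beta> ^ 3 = B" "u \<noteq> 0"
        using b_nonzero cubes_mult nonzero by (auto simp: B_def u_def)
      \<comment> \<open>The three cases make \<open>b\<close>, the inverse of
        \<open>\<alpha> ^ 3\<close>, or the inverse of \<open>\<beta> ^ 3\<close> a cube in
        \<open>K\<close>; the last one uses \<open>b = \<alpha> ^ 3 * \<beta> ^ 3\<close>.\<close>
      from cases consider "y ^ 3 = of_int b" | "B = y ^ 3 * (B * u)" | "B = y ^ 3 * (B * u) ^ 2"
        unfolding x(2) w_cube t_cube B_def [symmetric] u_def [symmetric] by metis
      then show False
      proof cases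
        case 1
        then obtain q where "q \<in> \<rat>" "q ^ 3 = (of_int b :: complex)"
          using cube_descends_Rats[OF y] by auto
        then obtain q' where "of_rat (q' ^ 3) = (of_rat (of_int b) :: complex)"
          by (auto elim!: Rats_cases simp: of_rat_power)
        then show False
          using not_cube by (metis of_rat_eq_iff)
      next
        case 2
        then have "B * (1 - y ^ 3 * u) = 0"
          by (simp add: algebra_simps)
        then have "y ^ 3 * u = 1"
          using B by simp
        then have "inverse y ^ 3 = \<alpha> ^ 3"
          unfolding u_def power_inverse by (rule inverse_unique)
        then show False
          using not_cubes_in_K(1) y subfield_closed[OF K] by metis
      next
        case 3
        then have "B * (1 - y ^ 3 * u ^ 2 * B) = 0"
          by (simp add: algebra_simps power2_eq_square)
        then have *: "y ^ 3 * u ^ 2 * B = 1"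
          using B by simp
        then have "(y * u) ^ 3 * \<beta> ^ 3 = 1"
          unfolding B(2) [symmetric] by (simp add: power_mult_distrib power2_eq_square power3_eq_cube algebra_simps)
        then have "inverse (y * u) ^ 3 = \<beta> ^ 3"
          unfolding power_inverse by (rule inverse_unique)
        then show False
          using not_cubes_in_K(2) y subfield_closed[OF K] cubes_in_K by (metis u_def)
      qed
    qed
  qed
  define W where "W = adjoin_cbrt T w"
  have W: "is_subfield W" "T \<subseteq> W" "w \<in> W"
    unfolding W_def using is_subfield_adjoin_cbrt[OF T(1) w_T] subset_adjoin_cbrt[OF T(1) w_T]
      in_adjoin_cbrt[OF T(1) w_T] by auto
  have t'_eq: "t' = of_int b / t"
    using tt' nz by (simp add: field_simps)
  have in_W: "sqrt_m3 \<in> W" "t \<in> W" "t' \<in> W" "\<alpha> \<in> W" "\<beta> \<in> W"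
  proof -
    show *: "sqrt_m3 \<in> W" "t \<in> W"
      using T W sqrt_m3_in_K by auto
    then show "t' \<in> W"
      unfolding t'_eq by (intro subfield_closed[OF W(1)])
    with * show "\<alpha> \<in> W" "\<beta> \<in> W"
      unfolding \<alpha>_eq \<beta>_eq by (auto intro: subfield_divide[OF W(1)] W(3))
  qed
  have in_S: "w \<in> S" "t \<in> S" "t' \<in> S"
    unfolding w_def t_def t'_def by (intro subfield_closed[OF S] roots_in_S)+
  \<comment> \<open>Two signs and two shifts modulo 3 give 36 embeddings. The slope on the cube
    roots of \<open>b\<close> is the sign on \<open>sqrt_m3\<close> alone; on the other cubic it
    also involves the sign on \<open>r\<close>, which is therefore chosen as
    \<open>e * d\<close>.\<close>
  have hom_on_W: "\<exists>\<phi>. field_hom_on W \<phi> \<and> (\<forall>j. \<phi> (cardano w 0 j) = cardano w 0 (d * j + k)) \<and>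
      (\<forall>j. \<phi> (cardano t t' j) = cardano t t' (e * j + l))"
    if d: "d \<in> {1, -1}" and e: "e \<in> {1, -1}" for d e k l :: int
  proof -
    have ed: "e * d \<in> {1, -1}" and edd: "e * d * d = e"
      using d e by auto
    obtain \<phi> where \<phi>: "field_hom_on K \<phi>" "\<phi> sqrt_m3 = of_int d * sqrt_m3"
        "\<phi> (\<alpha> ^ 3) = (if e * d = 1 then \<alpha> ^ 3 else \<beta> ^ 3)"
      using hom_on_K[OF d ed] by metis
    define y z where "y = (if e * d = 1 then omega powi l * t else omega powi (- l) * t')"
      and "z = (if e * d = 1 then omega powi (- l) * t' else omega powi l * t)"
    have "y ^ 3 = of_int b * \<phi> (\<alpha> ^ 3)"
      by (simp add: y_def \<phi> power_mult_distrib omega_powi_cubed t_cube t'_cube)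
    also have "\<dots> = \<phi> (t ^ 3)"
      unfolding t_cube
      by (simp only: hom_mult[OF K \<phi>(1)] hom_of_int[OF K \<phi>(1)] subfield_of_int[OF K] cubes_in_K)
    finally obtain \<chi> where \<chi>: "field_hom_on T \<chi>" "\<And>x. x \<in> K \<Longrightarrow> \<chi> x = \<phi> x" "\<chi> t = y"
      unfolding T_def using hom_extend_cbrt[OF K t_K \<phi>(1)] by metis
    have "(omega powi k * w) ^ 3 = \<chi> (w ^ 3)"
      by (simp add: power_mult_distrib omega_powi_cubed w_cube hom_of_int[OF T(1) \<chi>(1)])
    then obtain \<psi> where \<psi>: "field_hom_on W \<psi>" "\<And>x. x \<in> T \<Longrightarrow> \<psi> x = \<chi> x" "\<psi> w = omega powi k * w"
      unfolding W_def using hom_extend_cbrt[OF T(1) w_T \<chi>(1)] by metis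
    have \<psi>t: "\<psi> t = y" and \<psi>s: "\<psi> sqrt_m3 = of_int d * sqrt_m3"
      using \<psi>(2) \<chi>(2,3) \<phi>(2) T sqrt_m3_in_K by auto
    have "\<psi> t' = of_int b / y"
      unfolding t'_eq \<psi>t [symmetric]
      by (simp add: hom_divide[OF W(1) \<psi>(1)] hom_of_int[OF W(1) \<psi>(1)] subfield_of_int[OF W(1)] in_W)
    also have "of_int b = y * z"
      unfolding tt' [symmetric] using omega_nonzero by (simp add: y_def z_def power_int_minus)
    also have "y * z / y = z"
      using nz omega_nonzero by (simp add: y_def)
    finally have \<psi>t': "\<psi> t' = z" .
    have "\<psi> (cardano t t' j) = cardano t t' (e * d * d * j + l)" for j
      using \<psi>t \<psi>t' by (intro hom_twist_cardano[OF W(1) \<psi>(1) in_W(1-3) d \<psi>s ed]) (simp_all add: y_def z_def)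
    moreover have "\<psi> (cardano w 0 j) = cardano w 0 (1 * d * j + k)" for j
      using \<psi>(3) hom_0[OF W(1) \<psi>(1)]
      by (intro hom_twist_cardano[OF W(1) \<psi>(1) in_W(1) W(3) subfield_0[OF W(1)] d \<psi>s]) simp_all
    ultimately show ?thesis
      unfolding edd using \<psi>(1) by (intro exI[of _ \<psi>]) simp
  qed
  define R where "R \<sigma> h \<longleftrightarrow> (\<forall>j\<in>{1..3}. \<sigma> (cardano w 0 (int j)) = cardano w 0 (int (fst h j)) \<and>
      \<sigma> (cardano t t' (int j)) = cardano t t' (int (snd h j)))"
    for \<sigma> :: "complex \<Rightarrow> complex" and h :: "(nat \<Rightarrow> nat) \<times> (nat \<Rightarrow> nat)"
  have card_in: "cardano w 0 j \<in> S" "cardano t t' j \<in> S" for j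
    by (intro cardano_in_S in_S subfield_0[OF S])+
  have perm_eq: "p = q"
    if perm: "p permutes {1..3::nat}" "q permutes {1..3}" and ne: "x ^ 3 \<noteq> y ^ 3"
      and eq: "\<And>j. j \<in> {1..3} \<Longrightarrow> cardano x y (int (p j)) = cardano x y (int (q j))"
    for p q x y
  proof
    fix j show "p j = q j"
    proof (cases "j \<in> {1..3}")
      case True
      then have "[int (p j) = int (q j)] (mod 3)"
        using eq cardano_eq_iff[OF ne] by blast
      then obtain m where "int (p j) - int (q j) = 3 * m"
        by (auto simp: cong_iff_dvd_diff elim: dvdE)
      moreover have "p j \<in> {1..3}" "q j \<in> {1..3}"
        using True permutes_in_image[OF perm(1)] permutes_in_image[OF perm(2)] by auto
      ultimately show ?thesis
        by simp presburger
    next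
      case False
      then show ?thesis
        using permutes_not_in[OF perm(1)] permutes_not_in[OF perm(2)] by simp
    qed
  qed
  have carrier: "carrier (sym_group 3 \<times>\<times> sym_group 3) = {p. p permutes {1..3}} \<times> {p. p permutes {1..3}}"
    by (simp add: DirProd_def sym_group_def)
  show ?thesis
  proof (rule galois_group_iso[where R = R])
    fix \<sigma> assume \<sigma>: "\<sigma> \<in> carrier G"
    obtain p where p: "p permutes {1..3::nat}"
        "\<forall>j\<in>{1..3}. \<sigma> (cardano w 0 (int j)) = cardano w 0 (int (p j))"
      using hom_permutes_cardano[OF S galois_hom[OF \<sigma>] card_in(1) _ _ w_ne] by (auto simp: w_cube)
    obtain q where q: "q permutes {1..3::nat}"
        "\<forall>j\<in>{1..3}. \<sigma> (cardano t t' (int j)) = cardano t t' (int (q j))"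
      using hom_permutes_cardano[OF S galois_hom[OF \<sigma>] card_in(2) _ _ t_ne] unfolding tt' t_add by auto
    have "R \<sigma> (p, q)"
      using p q by (simp add: R_def)
    moreover have "(p, q) \<in> carrier (sym_group 3 \<times>\<times> sym_group 3)"
      unfolding carrier using p q by blast
    ultimately show "\<exists>h\<in>carrier (sym_group 3 \<times>\<times> sym_group 3). R \<sigma> h"
      by blast
  next
    fix \<sigma> h h'
    assume h: "h \<in> carrier (sym_group 3 \<times>\<times> sym_group 3)" "h' \<in> carrier (sym_group 3 \<times>\<times> sym_group 3)"
      and R: "R \<sigma> h" "R \<sigma> h'"
    have perm: "fst h permutes {1..3}" "snd h permutes {1..3}" "fst h' permutes {1..3}" "snd h' permutes {1..3}"
      using h unfolding carrier by auto
    have "fst h = fst h'"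
      using R by (intro perm_eq[OF perm(1,3) w_ne]) (simp add: R_def)
    moreover have "snd h = snd h'"
      using R by (intro perm_eq[OF perm(2,4) t_ne]) (simp add: R_def)
    ultimately show "h = h'"
      by (simp add: prod_eq_iff)
  next
    fix h assume "h \<in> carrier (sym_group 3 \<times>\<times> sym_group 3)"
    then obtain p q where h: "h = (p, q)" and pq: "p permutes {1..3}" "q permutes {1..3}"
      unfolding carrier by blast
    obtain d k where dk: "d \<in> {1, -1}" "\<forall>j\<in>{1..3}. [int (p j) = d * int j + k] (mod 3)"
      using permutes_affine_mod_3[OF pq(1)] by blast
    obtain e l where el: "e \<in> {1, -1}" "\<forall>j\<in>{1..3}. [int (q j) = e * int j + l] (mod 3)"
      using permutes_affine_mod_3[OF pq(2)] by blast
    obtain \<phi> where \<phi>: "field_hom_on W \<phi>" "\<And>j. \<phi> (cardano w 0 j) = cardano w 0 (d * j + k)"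
        "\<And>j. \<phi> (cardano t t' j) = cardano t t' (e * j + l)"
      using hom_on_W[OF dk(1) el(1)] by blast
    have "R (restrict \<phi> S) h"
      unfolding R_def
    proof (intro ballI conjI)
      fix j :: nat assume j: "j \<in> {1..3}"
      show "restrict \<phi> S (cardano w 0 (int j)) = cardano w 0 (int (fst h j))"
        using cardano_cong[OF bspec[OF dk(2) j]] \<phi>(2) card_in by (simp add: h)
      show "restrict \<phi> S (cardano t t' (int j)) = cardano t t' (int (snd h j))"
        using cardano_cong[OF bspec[OF el(2) j]] \<phi>(3) card_in by (simp add: h)
    qed
    moreover have "restrict \<phi> S \<in> carrier G"
      by (intro restrict_in_G[OF \<phi>(1)] W(1) in_W)
    ultimately show "\<exists>\<sigma>\<in>carrier G. R \<sigma> h"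
      by blast
  next
    fix \<sigma> \<tau> h
    assume \<sigma>: "\<sigma> \<in> carrier G" "\<tau> \<in> carrier G" and R: "R \<sigma> h" "R \<tau> h"
    let ?A = "(\<lambda>j. cardano w 0 (int j)) ` {1..3} \<union> (\<lambda>j. cardano t t' (int j)) ` {1..3}"
    show "\<sigma> = \<tau>"
    proof (rule galois_group_eqI[OF \<sigma>, where A = ?A])
      show "?A \<subseteq> S"
        using card_in by blast
      show "\<sigma> x = \<tau> x" if "x \<in> ?A" for x
        using that R unfolding R_def by (elim UnE imageE) simp_all
      fix M assume M: "is_subfield M" "?A \<subseteq> M"
      have "(1::nat) \<in> {1..3}" "(3::nat) \<in> {1..3}"
        by simp_all
      then have "cardano w 0 (int 1) \<in> M" "cardano w 0 (int 3) \<in> M"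
          "cardano t t' (int 1) \<in> M" "cardano t t' (int 3) \<in> M"
        using M(2) by blast+
      then have M': "omega * w \<in> M" "w \<in> M" "cardano t t' 1 \<in> M" "cardano t t' 3 \<in> M"
        by (simp_all add: cardano_values)
      \<comment> \<open>\<open>omega\<close> is the quotient of two cube roots of \<open>b\<close>,
        so the roots of both cubics already generate \<open>sqrt_m3\<close>.\<close>
      have "sqrt_m3 = 2 * (omega * w / w) + 1"
        using nz by (simp add: sqrt_m3_eq)
      also have "\<dots> \<in> M"
        by (intro subfield_add[OF M(1)] subfield_mult[OF M(1)] subfield_divide[OF M(1)]
            subfield_numeral[OF M(1)] subfield_1[OF M(1)] M')
      finally have s: "sqrt_m3 \<in> M" .
      have "t \<in> M" "t' \<in> M"
        using cardano_generators[OF M(1) s M'(3,4)] .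
      then have "\<alpha> \<in> M" "\<beta> \<in> M"
        unfolding \<alpha>_eq \<beta>_eq by (auto intro: subfield_divide[OF M(1)] M')
      then show "rat_roots f \<subseteq> M"
        by (intro roots_subset M(1) s)
    qed
  next
    fix \<sigma> \<tau> h h'
    assume h: "h \<in> carrier (sym_group 3 \<times>\<times> sym_group 3)" "h' \<in> carrier (sym_group 3 \<times>\<times> sym_group 3)"
      and R: "R \<sigma> h" "R \<tau> h'"
    obtain p q p' q' where pq: "h = (p, q)" "h' = (p', q')"
      by (cases h; cases h')
    have perm: "p permutes {1..3}" "q permutes {1..3}" "p' permutes {1..3}" "q' permutes {1..3}"
      using h unfolding carrier pq by blast+
    have mult: "h \<otimes>\<^bsub>sym_group 3 \<times>\<times> sym_group 3\<^esub> h' = (p \<circ> p', q \<circ> q')"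
      by (simp add: pq DirProd_def sym_group_def)
    have "R (compose S \<sigma> \<tau>) (p \<circ> p', q \<circ> q')"
      using R card_in permutes_in_image[OF perm(3)] permutes_in_image[OF perm(4)]
      unfolding R_def pq by (simp add: compose_def)
    moreover have "(p \<circ> p', q \<circ> q') \<in> carrier (sym_group 3 \<times>\<times> sym_group 3)"
      unfolding carrier using perm by (simp add: permutes_compose)
    ultimately show "h \<otimes>\<^bsub>sym_group 3 \<times>\<times> sym_group 3\<^esub> h' \<in> carrier (sym_group 3 \<times>\<times> sym_group 3) \<and>
        R (compose S \<sigma> \<tau>) (h \<otimes>\<^bsub>sym_group 3 \<times>\<times> sym_group 3\<^esub> h')"
      by (simp add: mult)
  qed
qed

end

subsection \<open>The four families\<close>

lemma complex_cube_root_exists: "\<exists>z::complex. z ^ 3 = c"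
proof
  show "rcis (root 3 (cmod c)) (Arg c / 3) ^ 3 = c"
    by (simp add: DeMoivre2 rcis_cmod_Arg)
qed

text \<open>A rational cube root would be an even integer, whose cube is divisible by 4.\<close>

lemma rat_cube_neq:
  fixes q :: rat
  assumes "[b = 2] (mod 4)"
  shows "q ^ 3 \<noteq> of_int b"
proof
  assume eq: "q ^ 3 = of_int b"
  then obtain k where k: "q = of_int k"
    using rational_cubic_root_is_int[of q 0 "- b"] by auto
  have "of_int (k ^ 3) = (of_int b :: rat)"
    using eq by (simp add: k)
  then have "k ^ 3 = b"
    by (simp only: of_int_eq_iff)
  moreover have "b mod 4 = 2"
    using assms by (simp add: cong_def)
  moreover have "even (k ^ 3)"
    using calculation by presburger
  then obtain l where "k = 2 * l"
    by auto
  then have "k ^ 3 = 4 * (2 * l ^ 3)"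
    by simp
  ultimately show False
    by presburger
qed

text \<open>A root would be an even integer \<open>2 * l\<close>. With \<open>b = 2 * c\<close>,
  \<open>c\<close> odd, dividing the equation by 2 makes the odd number \<open>a * c\<close>
  even.\<close>

lemma rat_cubic_no_root:
  fixes s :: rat
  assumes b: "[b = 2] (mod 4)" and a: "odd a"
  shows "s ^ 3 - 3 * of_int b * s + of_int (a * b) \<noteq> 0"
proof
  assume eq: "s ^ 3 - 3 * of_int b * s + of_int (a * b) = 0"
  then obtain k where k: "s = of_int k"
    using rational_cubic_root_is_int[of s "- 3 * b" "a * b"] by auto
  have "of_int (k ^ 3 - 3 * b * k + a * b) = (of_int 0 :: rat)"
    using eq by (simp add: k)
  then have eq: "k ^ 3 - 3 * b * k + a * b = 0"
    by (simp only: of_int_eq_iff)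
  have "even b"
    using b by (simp add: cong_def) presburger
  then obtain c where c: "b = 2 * c"
    by auto
  have "odd c"
    using b unfolding c by (simp add: cong_def) presburger
  have "even (k ^ 3)"
    using arg_cong[OF eq, of even] \<open>even b\<close> by simp
  then obtain l where l: "k = 2 * l"
    by auto
  have "2 * (4 * l ^ 3 - 6 * c * l + a * c) = 0"
    using eq unfolding c l by (simp add: algebra_simps)
  then have "a * c = 2 * (3 * c * l - 2 * l ^ 3)"
    by (simp add: algebra_simps)
  then have "even (a * c)"
    by simp
  with a \<open>odd c\<close> show False
    by simp
qed

theorem corollary3p5:
  fixes a b \<Delta> :: int and f :: "rat poly" and F :: "complex ring"
  assumes f: "f = monom 1 6 + monom (of_int a) 3 + [:of_int b:]"
    and \<Delta>: "\<Delta> = a^2 - 4 * b"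
    and F: "F = splitting_field f"
    and irred: "Factorial_Ring.irreducible f"
    and not_sq: "\<forall>n::rat. of_int \<Delta> \<noteq> - 3 * n^2"
  shows "(b = 2 \<and> [a = 1] (mod 10)
            \<longrightarrow> galois_group F \<rat> \<cong> sym_group 3 \<times>\<times> sym_group 3)
       \<and> ((\<exists>m::int. m \<le> -1 \<and> b = 27 * (100 * m + 23)^3 + 1) \<and> [a = 25] (mod 30)
            \<longrightarrow> galois_group F \<rat> \<cong> sym_group 3 \<times>\<times> sym_group 3)
       \<and> ([b = 10] (mod 12) \<and> a = 0
            \<longrightarrow> galois_group F \<rat> \<cong> dihedral_group 6)
       \<and> ((\<exists>m::int. m > 0 \<and> b = - ((5 * m + 1)^3)) \<and> [a = 3] (mod 5)
            \<longrightarrow> galois_group F \<rat> \<cong> dihedral_group 6)"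
proof -
  define r where "r = csqrt (of_int (a ^ 2 - 4 * b))"
  have r: "r ^ 2 = of_int (a ^ 2 - 4 * b)"
    unfolding r_def by (rule power2_csqrt)
  obtain \<alpha> where \<alpha>: "\<alpha> ^ 3 = (- of_int a + r) / 2"
    using complex_cube_root_exists by blast
  \<comment> \<open>\<open>\<beta>\<close> stays open: the three cases below take an arbitrary cube
    root, \<open>- \<alpha>\<close>, and \<open>of_int c / \<alpha>\<close>.\<close>
  have sextic: "sextic a b f r \<alpha> \<beta>" if "\<beta> ^ 3 = (- of_int a - r) / 2" for \<beta>
    using f irred not_sq r \<alpha> that unfolding \<Delta> by unfold_locales auto
  have generic: "galois_group F \<rat> \<cong> sym_group 3 \<times>\<times> sym_group 3" if "[b = 2] (mod 4)" "odd a"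
  proof -
    obtain \<beta> where "\<beta> ^ 3 = (- of_int a - r) / 2"
      using complex_cube_root_exists by blast
    then interpret sextic a b f r \<alpha> \<beta>
      by (rule sextic)
    show ?thesis
      unfolding F by (intro galois_group_generic rat_cube_neq rat_cubic_no_root that)
  qed
  have pure: "galois_group F \<rat> \<cong> dihedral_group 6" if "a = 0"
  proof -
    have "(- \<alpha>) ^ 3 = (- of_int a - r) / 2"
      using \<alpha> that by simp
    then interpret sextic a b f r \<alpha> "- \<alpha>"
      by (rule sextic)
    show ?thesis
      unfolding F by (intro galois_group_pure that refl)
  qed
  have cube: "galois_group F \<rat> \<cong> dihedral_group 6" if c: "b = c ^ 3" "c \<noteq> 0" for c
  proof -
    have prod: "\<alpha> ^ 3 * ((- of_int a - r) / 2) = of_int c ^ 3"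
    proof -
      have "\<alpha> ^ 3 * ((- of_int a - r) / 2) = (of_int a ^ 2 - r ^ 2) / 4"
        unfolding \<alpha> by (simp add: algebra_simps power2_eq_square)
      then show ?thesis
        unfolding r by (simp add: c)
    qed
    then have nz: "\<alpha> \<noteq> 0"
      using c(2) by auto
    then have "(of_int c / \<alpha>) ^ 3 = (- of_int a - r) / 2"
      unfolding power_divide prod [symmetric] by simp
    then interpret sextic a b f r \<alpha> "of_int c / \<alpha>"
      by (rule sextic)
    show ?thesis
      unfolding F using nz by (intro galois_group_cube[of c]) simp
  qed
  show ?thesis
  proof (intro conjI impI; elim conjE exE)
    assume "b = 2" "[a = 1] (mod 10)"
    then show "galois_group F \<rat> \<cong> sym_group 3 \<times>\<times> sym_group 3"
      by (intro generic) (auto simp: cong_def, presburger)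
  next
    fix m assume m: "b = 27 * (100 * m + 23) ^ 3 + 1" and a: "[a = 25] (mod 30)"
    \<comment> \<open>In the expansion the constant part is
      \<open>27 * 23 ^ 3 - 1 = 4 * 82127\<close>, and every other term carries a factor 100.\<close>
    have "b - 2 = 4 * (27 * (250000 * m ^ 3 + 172500 * m ^ 2 + 39675 * m) + 82127)"
      unfolding m by (simp add: power2_eq_square power3_eq_cube algebra_simps)
    then have "[b = 2] (mod 4)"
      unfolding cong_iff_dvd_diff by (metis dvd_triv_left)
    moreover have "odd a"
      using a by (simp add: cong_def) presburger
    ultimately show "galois_group F \<rat> \<cong> sym_group 3 \<times>\<times> sym_group 3"
      by (rule generic)
  next
    assume "a = 0"
    then show "galois_group F \<rat> \<cong> dihedral_group 6"
      by (rule pure)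
  next
    fix m :: int assume "m > 0" "b = - ((5 * m + 1) ^ 3)"
    then show "galois_group F \<rat> \<cong> dihedral_group 6"
      by (intro cube[of "- (5 * m + 1)"]) (simp_all add: power3_eq_cube algebra_simps)
  qed
qed

end
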